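(* Let $p$ be a prime, $n\ge 1$, let $G$ be a finite group, and let $(G,\mathbb{F}_{p^n},\sigma,\alpha)$ be a crossed system. If $G$ is $p$-nilpotent with a cyclic Sylow $p$-subgroup, then the twisted skew group ring $\mathbb{F}_{p^n}^\alpha[G,\sigma]$ is code-checkable, i.e. every right ideal $I$ of $A=\mathbb{F}_{p^n}^\alpha[G,\sigma]$ is of the form $I=\{a\in A \mid va=0\}$ for some $v\in A$.
   Context: A crossed system $(G,\mathbb{F}_{p^n},\sigma,\alpha)$ consists of a group $G$, the finite field $\mathbb{F}_{p^n}$, and maps $\sigma:G\to \mathrm{Aut}(\mathbb{F}_{p^n})$ and $\alpha:G\times G\to \mathbb{F}_{p^n}^*$ such that, writing ${}^{g}b=\sigma(g)(b)$: (1) ${}^{x}({}^{y}b)=\alpha(x,y)\,{}^{xy}b\,\alpha(x,y)^{-1}$ for all $b\in\mathbb{F}_{p^n}$, $x,y\in G$; (2) $\alpha(x,y)\alpha(xy,z)={}^{x}\alpha(y,z)\,\alpha(x,yz)$ for all $x,y,z\in G$; (3) $\alpha(x,e)=\alpha(e,x)=1$ for all $x\in G$, where $e$ is the identity of $G$. The twisted skew group ring $\mathbb{F}_{p^n}^\alpha[G,\sigma]$ is the free (left) $\mathbb{F}_{p^n}$-module with basis $\{\overline{g}\mid g\in G\}$ and multiplication extended additively from $(a\overline{x})(b\overline{y})=a\,{}^{x}b\,\alpha(x,y)\,\overline{xy}$. A finite group is $p$-nilpotent if its elements of order coprime to $p$ form a subgroup (equivalently, it has a normal $p$-complement). A right ideal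 $I$ of a ring $A$ is checkable if there is $v\in A$ with $I=\mathrm{Ann}_r(v)=\{a\in A\mid va=0\}$; $A$ is code-checkable if all its right ideals are checkable. *)

theory Defs
  imports "HOL-Algebra.Algebra"
begin

section \<open>Finite groups\<close>

definition sylow_subgroup :: "nat \<Rightarrow> 'a set \<Rightarrow> ('a, 'b) monoid_scheme \<Rightarrow> bool" where
  "sylow_subgroup p P G \<longleftrightarrow> subgroup P G \<and> card P = p ^ multiplicity p (order G)"

text \<open>Meant for a finite group and a prime number.\<close>

definition p_nilpotent :: "nat \<Rightarrow> ('a, 'b) monoid_scheme \<Rightarrow> bool" where
  "p_nilpotent p G \<longleftrightarrow> subgroup {x \<in> carrier G. coprime (group.ord G x) p} G"


section \<open>Checkable right ideals\<close>

locale right_ideal = additive_subgroup I R + ring R for I and R (structure) +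
  assumes I_r_closed: "\<lbrakk>a \<in> I; x \<in> carrier R\<rbrakk> \<Longrightarrow> a \<otimes> x \<in> I"

definition right_annihilator :: "('a, 'b) ring_scheme \<Rightarrow> 'a \<Rightarrow> 'a set" where
  "right_annihilator A v = {a \<in> carrier A. v \<otimes>\<^bsub>A\<^esub> a = \<zero>\<^bsub>A\<^esub>}"

definition checkable :: "'a set \<Rightarrow> ('a, 'b) ring_scheme \<Rightarrow> bool" where
  "checkable I A \<longleftrightarrow> (\<exists>v \<in> carrier A. I = right_annihilator A v)"

definition code_checkable :: "('a, 'b) ring_scheme \<Rightarrow> bool" where
  "code_checkable A \<longleftrightarrow> (\<forall>I. right_ideal I A \<longrightarrow> checkable I A)"


section \<open>Crossed systems and twisted skew group rings\<close>

locale crossed_system = G?: group G + K?: field K for G (structure) and K (structure) +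
  fixes \<sigma> :: "'a \<Rightarrow> 'c \<Rightarrow> 'c" and \<alpha> :: "'a \<Rightarrow> 'a \<Rightarrow> 'c"
  assumes sigma_aut: "x \<in> carrier G \<Longrightarrow> \<sigma> x \<in> ring_iso K K"
    and alpha_closed: "\<lbrakk>x \<in> carrier G; y \<in> carrier G\<rbrakk> \<Longrightarrow> \<alpha> x y \<in> carrier (mult_of K)"
    and sigma_sigma: "\<lbrakk>x \<in> carrier G; y \<in> carrier G; b \<in> carrier K\<rbrakk> \<Longrightarrow>
      \<sigma> x (\<sigma> y b) = \<alpha> x y \<otimes>\<^bsub>K\<^esub> \<sigma> (x \<otimes>\<^bsub>G\<^esub> y) b \<otimes>\<^bsub>K\<^esub> inv\<^bsub>K\<^esub> \<alpha> x y"
    and cocycle: "\<lbrakk>x \<in> carrier G; y \<in> carrier G; z \<in> carrier G\<rbrakk> \<Longrightarrow>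
      \<alpha> x y \<otimes>\<^bsub>K\<^esub> \<alpha> (x \<otimes>\<^bsub>G\<^esub> y) z = \<sigma> x (\<alpha> y z) \<otimes>\<^bsub>K\<^esub> \<alpha> x (y \<otimes>\<^bsub>G\<^esub> z)"
    and alpha_r_one: "x \<in> carrier G \<Longrightarrow> \<alpha> x \<one>\<^bsub>G\<^esub> = \<one>\<^bsub>K\<^esub>"
    and alpha_l_one: "x \<in> carrier G \<Longrightarrow> \<alpha> \<one>\<^bsub>G\<^esub> x = \<one>\<^bsub>K\<^esub>"

definition coeff_support ::
    "('a, 'b) monoid_scheme \<Rightarrow> ('c, 'd) ring_scheme \<Rightarrow> ('a \<Rightarrow> 'c) \<Rightarrow> 'a set" where
  "coeff_support G K f = {x \<in> carrier G. f x \<noteq> \<zero>\<^bsub>K\<^esub>}"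

text \<open>
  An element $\sum_g a_g \overline{g}$ is represented by its coefficient function $g \mapsto a_g$,
  finitely supported and made canonical by being undefined outside the carrier of the group.
  The product extends $(a\overline{x})(b\overline{y}) = a\,{}^{x}b\,\alpha(x,y)\,\overline{xy}$
  bi-additively.
\<close>

definition twisted_skew_group_ring ::
    "('a, 'b) monoid_scheme \<Rightarrow> ('c, 'd) ring_scheme \<Rightarrow> ('a \<Rightarrow> 'c \<Rightarrow> 'c) \<Rightarrow> ('a \<Rightarrow> 'a \<Rightarrow> 'c)
      \<Rightarrow> ('a \<Rightarrow> 'c) ring" where
  "twisted_skew_group_ring G K \<sigma> \<alpha> =
    \<lparr> carrier = {f \<in> carrier G \<rightarrow>\<^sub>E carrier K. finite (coeff_support G K f)},
      monoid.mult = (\<lambda>f h. \<lambda>g \<in> carrier G.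
        finsum K (\<lambda>(x, y). f x \<otimes>\<^bsub>K\<^esub> \<sigma> x (h y) \<otimes>\<^bsub>K\<^esub> \<alpha> x y)
          {(x, y) \<in> coeff_support G K f \<times> coeff_support G K h. x \<otimes>\<^bsub>G\<^esub> y = g}),
      monoid.one = (\<lambda>g \<in> carrier G. if g = \<one>\<^bsub>G\<^esub> then \<one>\<^bsub>K\<^esub> else \<zero>\<^bsub>K\<^esub>),
      ring.zero = (\<lambda>g \<in> carrier G. \<zero>\<^bsub>K\<^esub>),
      ring.add = (\<lambda>f h. \<lambda>g \<in> carrier G. f g \<oplus>\<^bsub>K\<^esub> h g) \<rparr>"

text \<open>
  The construction is a ring, so the right ideals above are those of an actual ring, and its
  product is the intended one on the basis.
\<close>

lemma (in comm_monoid) finprod_swap: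
  assumes "finite A" "finite B" "\<And>i j. i \<in> A \<Longrightarrow> j \<in> B \<Longrightarrow> f i j \<in> carrier G"
  shows "finprod G (\<lambda>i. finprod G (f i) B) A = finprod G (\<lambda>j. finprod G (\<lambda>i. f i j) A) B"
  using assms(1) assms(3)
proof (induction A rule: finite_induct)
  case (insert a A)
  have "finprod G (\<lambda>i. finprod G (f i) B) (insert a A)
      = finprod G (f a) B \<otimes> finprod G (\<lambda>i. finprod G (f i) B) A"
    using insert.hyps insert.prems by (intro finprod_insert) (auto simp: Pi_def intro!: finprod_closed)
  also have "\<dots> = finprod G (f a) B \<otimes> finprod G (\<lambda>j. finprod G (\<lambda>i. f i j) A) B"
    using insert by simp
  also have "\<dots> = finprod G (\<lambda>j. f a j \<otimes> finprod G (\<lambda>i. f i j) A) B"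
    using insert.prems by (intro finprod_multf[symmetric]) (auto simp: Pi_def intro!: finprod_closed)
  also have "\<dots> = finprod G (\<lambda>j. finprod G (\<lambda>i. f i j) (insert a A)) B"
    using insert.hyps insert.prems
    by (intro finprod_cong') (auto simp: Pi_def finprod_insert intro!: finprod_closed)
  finally show ?case .
qed simp

context crossed_system
begin

abbreviation (input) skew_ring where "skew_ring \<equiv> twisted_skew_group_ring G K \<sigma> \<alpha>"
abbreviation (input) supp where "supp \<equiv> coeff_support G K"
definition coeff_term where "coeff_term f h x y = f x \<otimes>\<^bsub>K\<^esub> \<sigma> x (h y) \<otimes>\<^bsub>K\<^esub> \<alpha> x y"

lemma skew_carrier: "f \<in> carrier skew_ring \<longleftrightarrow> f \<in> carrier G \<rightarrow>\<^sub>E carrier K \<and> finite (supp f)"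
  by (simp add: twisted_skew_group_ring_def)

lemma skew_mult_coeff: "g \<in> carrier G \<Longrightarrow> (f \<otimes>\<^bsub>skew_ring\<^esub> h) g
  = finsum K (\<lambda>(x, y). coeff_term f h x y) {(x, y) \<in> supp f \<times> supp h. x \<otimes>\<^bsub>G\<^esub> y = g}"
  by (simp add: twisted_skew_group_ring_def coeff_term_def)

lemma skew_add_coeff: "g \<in> carrier G \<Longrightarrow> (f \<oplus>\<^bsub>skew_ring\<^esub> h) g = f g \<oplus>\<^bsub>K\<^esub> h g"
  by (simp add: twisted_skew_group_ring_def)
lemma skew_zero_coeff: "g \<in> carrier G \<Longrightarrow> \<zero>\<^bsub>skew_ring\<^esub> g = \<zero>\<^bsub>K\<^esub>"
  by (simp add: twisted_skew_group_ring_def)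
lemma skew_one_coeff: "g \<in> carrier G \<Longrightarrow> \<one>\<^bsub>skew_ring\<^esub> g = (if g = \<one>\<^bsub>G\<^esub> then \<one>\<^bsub>K\<^esub> else \<zero>\<^bsub>K\<^esub>)"
  by (simp add: twisted_skew_group_ring_def)

lemma skew_extensional: "f \<otimes>\<^bsub>skew_ring\<^esub> h \<in> extensional (carrier G)" "f \<oplus>\<^bsub>skew_ring\<^esub> h \<in> extensional (carrier G)"
  "\<one>\<^bsub>skew_ring\<^esub> \<in> extensional (carrier G)" "\<zero>\<^bsub>skew_ring\<^esub> \<in> extensional (carrier G)"
  by (simp_all add: twisted_skew_group_ring_def)

lemma skew_coeff [simp]: "f \<in> carrier skew_ring \<Longrightarrow> x \<in> carrier G \<Longrightarrow> f x \<in> carrier K"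
  by (auto simp: skew_carrier)
lemma skew_finite_supp [simp]: "f \<in> carrier skew_ring \<Longrightarrow> finite (supp f)"
  by (auto simp: skew_carrier)
lemma supp_subset: "supp f \<subseteq> carrier G" by (auto simp: coeff_support_def)

lemma alpha_simps [simp]: "x \<in> carrier G \<Longrightarrow> y \<in> carrier G \<Longrightarrow> \<alpha> x y \<in> carrier K"
  "x \<in> carrier G \<Longrightarrow> y \<in> carrier G \<Longrightarrow> \<alpha> x y \<noteq> \<zero>\<^bsub>K\<^esub>"
  using alpha_closed[of x y] by auto

lemma sigma_ring_hom: assumes "x \<in> carrier G" shows "ring_hom_ring K K (\<sigma> x)"
  using sigma_aut[OF assms] unfolding ring_iso_def
  by (auto intro!: ring_hom_ringI2 K.ring_axioms)

lemma sigma_closed [simp]: "x \<in> carrier G \<Longrightarrow> b \<in> carrier K \<Longrightarrow> \<sigma> x b \<in> carrier K"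
  using ring_iso_memE(1)[OF sigma_aut] by blast
lemma sigma_simps [simp]:
  assumes "x \<in> carrier G"
  shows "b \<in> carrier K \<Longrightarrow> c \<in> carrier K \<Longrightarrow> \<sigma> x (b \<otimes>\<^bsub>K\<^esub> c) = \<sigma> x b \<otimes>\<^bsub>K\<^esub> \<sigma> x c"
   "b \<in> carrier K \<Longrightarrow> c \<in> carrier K \<Longrightarrow> \<sigma> x (b \<oplus>\<^bsub>K\<^esub> c) = \<sigma> x b \<oplus>\<^bsub>K\<^esub> \<sigma> x c"
   "\<sigma> x \<one>\<^bsub>K\<^esub> = \<one>\<^bsub>K\<^esub>" "\<sigma> x \<zero>\<^bsub>K\<^esub> = \<zero>\<^bsub>K\<^esub>"
  using ring_iso_memE[OF sigma_aut[OF assms]] ring_hom_ring.homh[OF sigma_ring_hom[OF assms]]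
     ring_hom_zero[OF _ K.ring_axioms K.ring_axioms] by blast+

lemma sigma_comp:
  assumes "x \<in> carrier G" "y \<in> carrier G" "b \<in> carrier K"
  shows "\<sigma> x (\<sigma> y b) = \<sigma> (x \<otimes>\<^bsub>G\<^esub> y) b"
proof -
  have u: "\<alpha> x y \<in> Units K" using assms by (simp add: K.field_Units)
  have "\<alpha> x y \<otimes>\<^bsub>K\<^esub> \<sigma> (x \<otimes>\<^bsub>G\<^esub> y) b \<otimes>\<^bsub>K\<^esub> inv\<^bsub>K\<^esub> \<alpha> x y
    = \<sigma> (x \<otimes>\<^bsub>G\<^esub> y) b \<otimes>\<^bsub>K\<^esub> \<alpha> x y \<otimes>\<^bsub>K\<^esub> inv\<^bsub>K\<^esub> \<alpha> x y"
    using assms by (simp add: K.m_comm)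
  also have "\<dots> = \<sigma> (x \<otimes>\<^bsub>G\<^esub> y) b"
    using assms u by (simp add: K.m_assoc)
  finally show ?thesis using sigma_sigma[OF assms] by simp
qed

lemma sigma_one: assumes "b \<in> carrier K" shows "\<sigma> \<one>\<^bsub>G\<^esub> b = b"
proof -
  have "bij_betw (\<sigma> \<one>\<^bsub>G\<^esub>) (carrier K) (carrier K)"
    using ring_iso_memE(5)[OF sigma_aut[OF G.one_closed]] .
  moreover have "\<sigma> \<one>\<^bsub>G\<^esub> (\<sigma> \<one>\<^bsub>G\<^esub> b) = \<sigma> \<one>\<^bsub>G\<^esub> b" using sigma_comp[of "\<one>\<^bsub>G\<^esub>" "\<one>\<^bsub>G\<^esub>" b] assms by simp
  ultimately show ?thesis using assms sigma_closed[of "\<one>\<^bsub>G\<^esub>" b] unfolding bij_betw_def inj_on_def by (metis G.one_closed)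
qed

lemma coeff_term_closed [simp]: "f \<in> carrier skew_ring \<Longrightarrow> h \<in> carrier skew_ring \<Longrightarrow> x \<in> carrier G \<Longrightarrow> y \<in> carrier G \<Longrightarrow> coeff_term f h x y \<in> carrier K"
  by (simp add: coeff_term_def)

lemma coeff_term_zero: "f \<in> carrier skew_ring \<Longrightarrow> h \<in> carrier skew_ring \<Longrightarrow> x \<in> carrier G \<Longrightarrow> y \<in> carrier G \<Longrightarrow> f x = \<zero>\<^bsub>K\<^esub> \<or> h y = \<zero>\<^bsub>K\<^esub> \<Longrightarrow> coeff_term f h x y = \<zero>\<^bsub>K\<^esub>"
  by (auto simp add: coeff_term_def)

lemma skew_mult_coeff_left:
  assumes "f \<in> carrier skew_ring" "h \<in> carrier skew_ring" "g \<in> carrier G" "finite S" "supp f \<subseteq> S" "S \<subseteq> carrier G"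
  shows "(f \<otimes>\<^bsub>skew_ring\<^esub> h) g = (\<Oplus>\<^bsub>K\<^esub>x\<in>S. coeff_term f h x (inv\<^bsub>G\<^esub> x \<otimes>\<^bsub>G\<^esub> g))"
proof -
  let ?B = "{x \<in> supp f. h (inv\<^bsub>G\<^esub> x \<otimes>\<^bsub>G\<^esub> g) \<noteq> \<zero>\<^bsub>K\<^esub>}"
  let ?j = "\<lambda>x. (x, inv\<^bsub>G\<^esub> x \<otimes>\<^bsub>G\<^esub> g)"
  have P: "{(x, y) \<in> supp f \<times> supp h. x \<otimes>\<^bsub>G\<^esub> y = g} = ?j ` ?B" (is "?P = _")
  proof (intro Set.set_eqI iffI)
    fix q assume "q \<in> ?P"
    then obtain x y where q: "q = (x,y)" "x \<in> supp f" "y \<in> supp h" "x \<otimes>\<^bsub>G\<^esub> y = g" by auto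
    then have "x \<in> carrier G" "y \<in> carrier G" "h y \<noteq> \<zero>\<^bsub>K\<^esub>" by (auto simp: coeff_support_def)
    then have "inv\<^bsub>G\<^esub> x \<otimes>\<^bsub>G\<^esub> g = y" using q G.inv_solve_left' assms(3) by blast
    then show "q \<in> ?j ` ?B" using q \<open>h y \<noteq> \<zero>\<^bsub>K\<^esub>\<close> by auto
  next
    fix q assume "q \<in> ?j ` ?B"
    then show "q \<in> ?P" using assms(3) by (auto simp: coeff_support_def G.m_assoc[symmetric])
  qed
  have "(f \<otimes>\<^bsub>skew_ring\<^esub> h) g = finsum K (\<lambda>(x, y). coeff_term f h x y) (?j ` ?B)"
    unfolding skew_mult_coeff[OF assms(3)] P ..
  also have "\<dots> = finsum K (\<lambda>x. coeff_term f h x (inv\<^bsub>G\<^esub> x \<otimes>\<^bsub>G\<^esub> g)) ?B"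
    using assms supp_subset[of f] by (subst K.finsum_reindex) (auto simp: inj_on_def Pi_def subset_iff)
  also have "\<dots> = (\<Oplus>\<^bsub>K\<^esub>x\<in>S. coeff_term f h x (inv\<^bsub>G\<^esub> x \<otimes>\<^bsub>G\<^esub> g))"
    using assms
    by (intro K.add.finprod_mono_neutral_cong_left)
       (auto simp: Pi_def subset_iff coeff_support_def intro!: coeff_term_zero)
  finally show ?thesis .
qed

lemma skew_mult_coeff_right:
  assumes "f \<in> carrier skew_ring" "h \<in> carrier skew_ring" "g \<in> carrier G" "finite S" "supp h \<subseteq> S" "S \<subseteq> carrier G"
  shows "(f \<otimes>\<^bsub>skew_ring\<^esub> h) g = (\<Oplus>\<^bsub>K\<^esub>y\<in>S. coeff_term f h (g \<otimes>\<^bsub>G\<^esub> inv\<^bsub>G\<^esub> y) y)"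
proof -
  let ?B = "{y \<in> supp h. f (g \<otimes>\<^bsub>G\<^esub> inv\<^bsub>G\<^esub> y) \<noteq> \<zero>\<^bsub>K\<^esub>}"
  let ?j = "\<lambda>y. (g \<otimes>\<^bsub>G\<^esub> inv\<^bsub>G\<^esub> y, y)"
  have P: "{(x, y) \<in> supp f \<times> supp h. x \<otimes>\<^bsub>G\<^esub> y = g} = ?j ` ?B" (is "?P = _")
  proof (intro Set.set_eqI iffI)
    fix q assume "q \<in> ?P"
    then obtain x y where q: "q = (x,y)" "x \<in> supp f" "y \<in> supp h" "x \<otimes>\<^bsub>G\<^esub> y = g" by auto
    then have "x \<in> carrier G" "y \<in> carrier G" "f x \<noteq> \<zero>\<^bsub>K\<^esub>" by (auto simp: coeff_support_def)
    then have "g \<otimes>\<^bsub>G\<^esub> inv\<^bsub>G\<^esub> y = x" using q G.inv_solve_right' assms(3) by blast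
    then show "q \<in> ?j ` ?B" using q \<open>f x \<noteq> \<zero>\<^bsub>K\<^esub>\<close> by auto
  next
    fix q assume "q \<in> ?j ` ?B"
    then show "q \<in> ?P" using assms(3) by (auto simp: coeff_support_def G.m_assoc)
  qed
  have "(f \<otimes>\<^bsub>skew_ring\<^esub> h) g = finsum K (\<lambda>(x, y). coeff_term f h x y) (?j ` ?B)"
    unfolding skew_mult_coeff[OF assms(3)] P ..
  also have "\<dots> = finsum K (\<lambda>y. coeff_term f h (g \<otimes>\<^bsub>G\<^esub> inv\<^bsub>G\<^esub> y) y) ?B"
    using assms supp_subset[of h] by (subst K.finsum_reindex) (auto simp: inj_on_def Pi_def subset_iff)
  also have "\<dots> = (\<Oplus>\<^bsub>K\<^esub>y\<in>S. coeff_term f h (g \<otimes>\<^bsub>G\<^esub> inv\<^bsub>G\<^esub> y) y)"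
    using assms
    by (intro K.add.finprod_mono_neutral_cong_left)
       (auto simp: Pi_def subset_iff coeff_support_def intro!: coeff_term_zero)
  finally show ?thesis .
qed

lemma skew_mult_closed:
  assumes "f \<in> carrier skew_ring" "h \<in> carrier skew_ring" shows "f \<otimes>\<^bsub>skew_ring\<^esub> h \<in> carrier skew_ring"
proof -
  have c: "(f \<otimes>\<^bsub>skew_ring\<^esub> h) g \<in> carrier K" if "g \<in> carrier G" for g
    using assms that by (simp only: skew_mult_coeff_left[OF assms that skew_finite_supp[OF assms(1)] order_refl supp_subset])
      (auto intro!: K.finsum_closed simp: Pi_def coeff_support_def)
  have "supp (f \<otimes>\<^bsub>skew_ring\<^esub> h) \<subseteq> (\<lambda>(x,y). x \<otimes>\<^bsub>G\<^esub> y) ` (supp f \<times> supp h)"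
  proof
    fix g assume g: "g \<in> supp (f \<otimes>\<^bsub>skew_ring\<^esub> h)"
    then have gG: "g \<in> carrier G" by (simp add: coeff_support_def)
    show "g \<in> (\<lambda>(x,y). x \<otimes>\<^bsub>G\<^esub> y) ` (supp f \<times> supp h)"
    proof (rule ccontr)
      assume "\<not> ?thesis"
      then have e: "{(x, y) \<in> supp f \<times> supp h. x \<otimes>\<^bsub>G\<^esub> y = g} = {}" by auto
      have "(f \<otimes>\<^bsub>skew_ring\<^esub> h) g = \<zero>\<^bsub>K\<^esub>" unfolding skew_mult_coeff[OF gG] e by (rule K.finsum_empty)
      then show False using g unfolding coeff_support_def[of G K "f \<otimes>\<^bsub>skew_ring\<^esub> h"] by blast
    qed
  qed
  then have "finite (supp (f \<otimes>\<^bsub>skew_ring\<^esub> h))"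
    by (rule finite_subset) (simp add: assms)
  moreover have "f \<otimes>\<^bsub>skew_ring\<^esub> h \<in> extensional (carrier G)" by (rule skew_extensional)
  ultimately show ?thesis using c unfolding skew_carrier PiE_def Pi_def by blast
qed

lemma skew_eqI: "f \<in> carrier skew_ring \<Longrightarrow> h \<in> carrier skew_ring \<Longrightarrow> (\<And>g. g \<in> carrier G \<Longrightarrow> f g = h g) \<Longrightarrow> f = h"
  unfolding skew_carrier by (meson PiE_ext)

lemma coeff_term_assoc:
  assumes "f \<in> carrier skew_ring" "h \<in> carrier skew_ring" "k \<in> carrier skew_ring" "x \<in> carrier G" "y \<in> carrier G" "z \<in> carrier G"
  shows "coeff_term f h x y \<otimes>\<^bsub>K\<^esub> \<sigma> (x \<otimes>\<^bsub>G\<^esub> y) (k z) \<otimes>\<^bsub>K\<^esub> \<alpha> (x \<otimes>\<^bsub>G\<^esub> y) z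
    = f x \<otimes>\<^bsub>K\<^esub> \<sigma> x (coeff_term h k y z) \<otimes>\<^bsub>K\<^esub> \<alpha> x (y \<otimes>\<^bsub>G\<^esub> z)"
proof -
  let ?s = "\<sigma> (x \<otimes>\<^bsub>G\<^esub> y) (k z)"
  have "coeff_term f h x y \<otimes>\<^bsub>K\<^esub> ?s \<otimes>\<^bsub>K\<^esub> \<alpha> (x \<otimes>\<^bsub>G\<^esub> y) z
     = (f x \<otimes>\<^bsub>K\<^esub> \<sigma> x (h y) \<otimes>\<^bsub>K\<^esub> ?s) \<otimes>\<^bsub>K\<^esub> (\<alpha> x y \<otimes>\<^bsub>K\<^esub> \<alpha> (x \<otimes>\<^bsub>G\<^esub> y) z)"
    using assms by (simp add: coeff_term_def K.m_ac)
  also have "\<dots> = (f x \<otimes>\<^bsub>K\<^esub> \<sigma> x (h y) \<otimes>\<^bsub>K\<^esub> ?s) \<otimes>\<^bsub>K\<^esub> (\<sigma> x (\<alpha> y z) \<otimes>\<^bsub>K\<^esub> \<alpha> x (y \<otimes>\<^bsub>G\<^esub> z))"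
    using assms by (simp add: cocycle)
  also have "\<dots> = f x \<otimes>\<^bsub>K\<^esub> \<sigma> x (coeff_term h k y z) \<otimes>\<^bsub>K\<^esub> \<alpha> x (y \<otimes>\<^bsub>G\<^esub> z)"
    using assms by (simp add: coeff_term_def sigma_comp K.m_ac)
  finally show ?thesis .
qed

lemma sigma_finsum:
  assumes "x \<in> carrier G" "u \<in> S \<rightarrow> carrier K"
  shows "\<sigma> x (finsum K u S) = finsum K (\<lambda>i. \<sigma> x (u i)) S"
  using ring_hom_ring.hom_finsum[OF sigma_ring_hom[OF assms(1)] assms(2)] by (simp add: o_def)

lemma skew_mult_assoc:
  assumes A: "f \<in> carrier skew_ring" "h \<in> carrier skew_ring" "k \<in> carrier skew_ring"
  shows "(f \<otimes>\<^bsub>skew_ring\<^esub> h) \<otimes>\<^bsub>skew_ring\<^esub> k = f \<otimes>\<^bsub>skew_ring\<^esub> (h \<otimes>\<^bsub>skew_ring\<^esub> k)"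
proof (rule skew_eqI)
  fix g assume g: "g \<in> carrier G"
  define F where "F x z = coeff_term f h x (inv\<^bsub>G\<^esub> x \<otimes>\<^bsub>G\<^esub> (g \<otimes>\<^bsub>G\<^esub> inv\<^bsub>G\<^esub> z)) \<otimes>\<^bsub>K\<^esub> \<sigma> (g \<otimes>\<^bsub>G\<^esub> inv\<^bsub>G\<^esub> z) (k z) \<otimes>\<^bsub>K\<^esub> \<alpha> (g \<otimes>\<^bsub>G\<^esub> inv\<^bsub>G\<^esub> z) z" for x z
  have sub: "x \<in> carrier G" if "x \<in> supp u" for x u using that by (simp add: coeff_support_def)
  have Fc: "F x z \<in> carrier K" if "x \<in> supp f" "z \<in> supp k" for x z
    using sub[OF that(1)] sub[OF that(2)] A g by (simp add: F_def)
  have "((f \<otimes>\<^bsub>skew_ring\<^esub> h) \<otimes>\<^bsub>skew_ring\<^esub> k) g = finsum K (\<lambda>z. coeff_term (f \<otimes>\<^bsub>skew_ring\<^esub> h) k (g \<otimes>\<^bsub>G\<^esub> inv\<^bsub>G\<^esub> z) z) (supp k)"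
    using A g by (intro skew_mult_coeff_right) (auto simp: skew_mult_closed sub)
  also have "\<dots> = finsum K (\<lambda>z. finsum K (\<lambda>x. F x z) (supp f)) (supp k)"
  proof (intro K.finsum_cong')
    fix z assume z: "z \<in> supp k"
    have zG: "z \<in> carrier G" using sub z by blast
    have m: "(f \<otimes>\<^bsub>skew_ring\<^esub> h) (g \<otimes>\<^bsub>G\<^esub> inv\<^bsub>G\<^esub> z) = finsum K (\<lambda>x. coeff_term f h x (inv\<^bsub>G\<^esub> x \<otimes>\<^bsub>G\<^esub> (g \<otimes>\<^bsub>G\<^esub> inv\<^bsub>G\<^esub> z))) (supp f)"
      using A g zG by (intro skew_mult_coeff_left) (auto simp: sub)
    have "coeff_term (f \<otimes>\<^bsub>skew_ring\<^esub> h) k (g \<otimes>\<^bsub>G\<^esub> inv\<^bsub>G\<^esub> z) z = 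
       finsum K (\<lambda>x. coeff_term f h x (inv\<^bsub>G\<^esub> x \<otimes>\<^bsub>G\<^esub> (g \<otimes>\<^bsub>G\<^esub> inv\<^bsub>G\<^esub> z)) \<otimes>\<^bsub>K\<^esub> \<sigma> (g \<otimes>\<^bsub>G\<^esub> inv\<^bsub>G\<^esub> z) (k z)) (supp f) \<otimes>\<^bsub>K\<^esub> \<alpha> (g \<otimes>\<^bsub>G\<^esub> inv\<^bsub>G\<^esub> z) z"
      unfolding coeff_term_def[of "f \<otimes>\<^bsub>skew_ring\<^esub> h"] m using A g zG sub
      by (subst K.finsum_ldistr) (auto simp: Pi_def)
    also have "\<dots> = finsum K (\<lambda>x. F x z) (supp f)"
      unfolding F_def using A g zG sub by (intro K.finsum_ldistr) (auto simp: Pi_def)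
    finally show "coeff_term (f \<otimes>\<^bsub>skew_ring\<^esub> h) k (g \<otimes>\<^bsub>G\<^esub> inv\<^bsub>G\<^esub> z) z = finsum K (\<lambda>x. F x z) (supp f)" .
  qed (use Fc in \<open>auto simp: Pi_def intro!: K.finsum_closed\<close>)
  also have "\<dots> = finsum K (\<lambda>x. finsum K (\<lambda>z. F x z) (supp k)) (supp f)"
    using A Fc by (intro K.add.finprod_swap) auto
  also have "\<dots> = finsum K (\<lambda>x. coeff_term f (h \<otimes>\<^bsub>skew_ring\<^esub> k) x (inv\<^bsub>G\<^esub> x \<otimes>\<^bsub>G\<^esub> g)) (supp f)"
  proof (intro K.finsum_cong')
    fix x assume x: "x \<in> supp f"
    have xG: "x \<in> carrier G" using sub x by blast
    let ?Y = "\<lambda>z. inv\<^bsub>G\<^esub> x \<otimes>\<^bsub>G\<^esub> g \<otimes>\<^bsub>G\<^esub> inv\<^bsub>G\<^esub> z"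
    have m: "(h \<otimes>\<^bsub>skew_ring\<^esub> k) (inv\<^bsub>G\<^esub> x \<otimes>\<^bsub>G\<^esub> g) = finsum K (\<lambda>z. coeff_term h k (?Y z) z) (supp k)"
      using A g xG by (intro skew_mult_coeff_right) (auto simp: sub)
    have "coeff_term f (h \<otimes>\<^bsub>skew_ring\<^esub> k) x (inv\<^bsub>G\<^esub> x \<otimes>\<^bsub>G\<^esub> g) = 
       f x \<otimes>\<^bsub>K\<^esub> finsum K (\<lambda>z. \<sigma> x (coeff_term h k (?Y z) z)) (supp k) \<otimes>\<^bsub>K\<^esub> \<alpha> x (inv\<^bsub>G\<^esub> x \<otimes>\<^bsub>G\<^esub> g)"
      unfolding coeff_term_def[of f "h \<otimes>\<^bsub>skew_ring\<^esub> k"] m using A g xG sub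
      by (subst sigma_finsum) (auto simp: Pi_def)
    also have "\<dots> = finsum K (\<lambda>z. f x \<otimes>\<^bsub>K\<^esub> \<sigma> x (coeff_term h k (?Y z) z)) (supp k) \<otimes>\<^bsub>K\<^esub> \<alpha> x (inv\<^bsub>G\<^esub> x \<otimes>\<^bsub>G\<^esub> g)"
      using A g xG sub by (subst K.finsum_rdistr) (auto simp: Pi_def)
    also have "\<dots> = finsum K (\<lambda>z. f x \<otimes>\<^bsub>K\<^esub> \<sigma> x (coeff_term h k (?Y z) z) \<otimes>\<^bsub>K\<^esub> \<alpha> x (inv\<^bsub>G\<^esub> x \<otimes>\<^bsub>G\<^esub> g)) (supp k)"
      using A g xG sub by (intro K.finsum_ldistr) (auto simp: Pi_def)
    also have "\<dots> = finsum K (\<lambda>z. F x z) (supp k)"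
    proof (intro K.finsum_cong')
      fix z assume z: "z \<in> supp k"
      have zG: "z \<in> carrier G" using sub z by blast
      have 1: "inv\<^bsub>G\<^esub> x \<otimes>\<^bsub>G\<^esub> (g \<otimes>\<^bsub>G\<^esub> inv\<^bsub>G\<^esub> z) = ?Y z" using g xG zG by (simp add: G.m_assoc)
      have 2: "x \<otimes>\<^bsub>G\<^esub> ?Y z = g \<otimes>\<^bsub>G\<^esub> inv\<^bsub>G\<^esub> z" using g xG zG by (simp add: G.m_assoc[symmetric])
      have 3: "?Y z \<otimes>\<^bsub>G\<^esub> z = inv\<^bsub>G\<^esub> x \<otimes>\<^bsub>G\<^esub> g" using g xG zG by (simp add: G.m_assoc)
      show "f x \<otimes>\<^bsub>K\<^esub> \<sigma> x (coeff_term h k (?Y z) z) \<otimes>\<^bsub>K\<^esub> \<alpha> x (inv\<^bsub>G\<^esub> x \<otimes>\<^bsub>G\<^esub> g) = F x z"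
        using coeff_term_assoc[OF A xG _ zG, of "?Y z"] g xG zG unfolding F_def 1 2 3 by simp
    qed (use x Fc in auto)
    finally show "finsum K (\<lambda>z. F x z) (supp k) = coeff_term f (h \<otimes>\<^bsub>skew_ring\<^esub> k) x (inv\<^bsub>G\<^esub> x \<otimes>\<^bsub>G\<^esub> g)" by simp
  qed (use A g sub in \<open>auto simp: Pi_def skew_mult_closed\<close>)
  also have "\<dots> = (f \<otimes>\<^bsub>skew_ring\<^esub> (h \<otimes>\<^bsub>skew_ring\<^esub> k)) g"
    using A g by (intro skew_mult_coeff_left[symmetric]) (auto simp: skew_mult_closed sub)
  finally show "((f \<otimes>\<^bsub>skew_ring\<^esub> h) \<otimes>\<^bsub>skew_ring\<^esub> k) g = (f \<otimes>\<^bsub>skew_ring\<^esub> (h \<otimes>\<^bsub>skew_ring\<^esub> k)) g" .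
qed (simp_all add: A skew_mult_closed)

lemma skew_add_closed: 
  assumes "f \<in> carrier skew_ring" "h \<in> carrier skew_ring" shows "f \<oplus>\<^bsub>skew_ring\<^esub> h \<in> carrier skew_ring"
proof -
  have "supp (f \<oplus>\<^bsub>skew_ring\<^esub> h) \<subseteq> supp f \<union> supp h" using assms by (auto simp: coeff_support_def skew_add_coeff)
  then have "finite (supp (f \<oplus>\<^bsub>skew_ring\<^esub> h))" using assms by (meson skew_finite_supp finite_Un finite_subset)
  then show ?thesis using assms skew_extensional unfolding skew_carrier PiE_def by (auto simp: Pi_def skew_add_coeff)
qed
lemma skew_zero_closed: "\<zero>\<^bsub>skew_ring\<^esub> \<in> carrier skew_ring"
proof -
  have "supp \<zero>\<^bsub>skew_ring\<^esub> = {}" by (auto simp: coeff_support_def skew_zero_coeff)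
  then show ?thesis using skew_extensional unfolding skew_carrier PiE_def by (auto simp: Pi_def skew_zero_coeff)
qed
lemma supp_one: "supp \<one>\<^bsub>skew_ring\<^esub> = {\<one>\<^bsub>G\<^esub>}" by (auto simp: coeff_support_def skew_one_coeff split: if_splits)
lemma skew_one_closed: "\<one>\<^bsub>skew_ring\<^esub> \<in> carrier skew_ring"
  using skew_extensional unfolding skew_carrier PiE_def by (auto simp: Pi_def skew_one_coeff supp_one)

lemma ring_skew_ring: "ring skew_ring"
proof (rule ringI)
  show "abelian_group skew_ring"
  proof (rule abelian_groupI)
    fix f assume f: "f \<in> carrier skew_ring"
    let ?m = "\<lambda>g\<in>carrier G. \<ominus>\<^bsub>K\<^esub> f g"
    have "supp ?m \<subseteq> supp f" using f by (auto simp: coeff_support_def)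
    then have "finite (supp ?m)" using skew_finite_supp[OF f] by (rule finite_subset)
    then have m: "?m \<in> carrier skew_ring" using f by (auto simp: skew_carrier)
    have "?m \<oplus>\<^bsub>skew_ring\<^esub> f = \<zero>\<^bsub>skew_ring\<^esub>"
      by (rule skew_eqI) (use f m in \<open>auto simp: skew_add_closed skew_zero_closed skew_add_coeff skew_zero_coeff K.l_neg\<close>)
    then show "\<exists>y\<in>carrier skew_ring. y \<oplus>\<^bsub>skew_ring\<^esub> f = \<zero>\<^bsub>skew_ring\<^esub>" using m by blast
  qed (auto intro!: skew_eqI simp: skew_add_closed skew_zero_closed skew_add_coeff skew_zero_coeff K.a_ac)
  show "monoid skew_ring"
  proof (rule monoidI)
    fix f assume f: "f \<in> carrier skew_ring"
    show "\<one>\<^bsub>skew_ring\<^esub> \<otimes>\<^bsub>skew_ring\<^esub> f = f"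
    proof (rule skew_eqI)
      fix g assume g: "g \<in> carrier G"
      have "(\<one>\<^bsub>skew_ring\<^esub> \<otimes>\<^bsub>skew_ring\<^esub> f) g = finsum K (\<lambda>x. coeff_term \<one>\<^bsub>skew_ring\<^esub> f x (inv\<^bsub>G\<^esub> x \<otimes>\<^bsub>G\<^esub> g)) {\<one>\<^bsub>G\<^esub>}"
        using f g by (intro skew_mult_coeff_left) (auto simp: skew_one_closed supp_one)
      also have "\<dots> = f g" using f g
        by (simp add: skew_one_closed) (simp add: coeff_term_def skew_one_coeff sigma_one alpha_l_one)
      finally show "(\<one>\<^bsub>skew_ring\<^esub> \<otimes>\<^bsub>skew_ring\<^esub> f) g = f g" .
    qed (simp_all add: f skew_one_closed skew_mult_closed)
    show "f \<otimes>\<^bsub>skew_ring\<^esub> \<one>\<^bsub>skew_ring\<^esub> = f"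
    proof (rule skew_eqI)
      fix g assume g: "g \<in> carrier G"
      have "(f \<otimes>\<^bsub>skew_ring\<^esub> \<one>\<^bsub>skew_ring\<^esub>) g = finsum K (\<lambda>x. coeff_term f \<one>\<^bsub>skew_ring\<^esub> (g \<otimes>\<^bsub>G\<^esub> inv\<^bsub>G\<^esub> x) x) {\<one>\<^bsub>G\<^esub>}"
        using f g by (intro skew_mult_coeff_right) (auto simp: skew_one_closed supp_one)
      also have "\<dots> = f g" using f g
        by (simp add: skew_one_closed) (simp add: coeff_term_def skew_one_coeff alpha_r_one)
      finally show "(f \<otimes>\<^bsub>skew_ring\<^esub> \<one>\<^bsub>skew_ring\<^esub>) g = f g" .
    qed (simp_all add: f skew_one_closed skew_mult_closed)
  qed (simp_all add: skew_mult_closed skew_one_closed skew_mult_assoc)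
next
  fix f h k assume A: "f \<in> carrier skew_ring" "h \<in> carrier skew_ring" "k \<in> carrier skew_ring"
  have sub: "x \<in> carrier G" if "x \<in> supp u" for x u using that by (simp add: coeff_support_def)
  show "(f \<oplus>\<^bsub>skew_ring\<^esub> h) \<otimes>\<^bsub>skew_ring\<^esub> k = f \<otimes>\<^bsub>skew_ring\<^esub> k \<oplus>\<^bsub>skew_ring\<^esub> h \<otimes>\<^bsub>skew_ring\<^esub> k"
  proof (rule skew_eqI)
    fix g assume g: "g \<in> carrier G"
    have "((f \<oplus>\<^bsub>skew_ring\<^esub> h) \<otimes>\<^bsub>skew_ring\<^esub> k) g = finsum K (\<lambda>y. coeff_term (f \<oplus>\<^bsub>skew_ring\<^esub> h) k (g \<otimes>\<^bsub>G\<^esub> inv\<^bsub>G\<^esub> y) y) (supp k)"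
      using A g by (intro skew_mult_coeff_right) (auto simp: skew_add_closed sub)
    also have "\<dots> = finsum K (\<lambda>y. coeff_term f k (g \<otimes>\<^bsub>G\<^esub> inv\<^bsub>G\<^esub> y) y \<oplus>\<^bsub>K\<^esub> coeff_term h k (g \<otimes>\<^bsub>G\<^esub> inv\<^bsub>G\<^esub> y) y) (supp k)"
      using A g sub by (intro K.finsum_cong') (auto simp: coeff_term_def skew_add_coeff K.l_distr)
    also have "\<dots> = finsum K (\<lambda>y. coeff_term f k (g \<otimes>\<^bsub>G\<^esub> inv\<^bsub>G\<^esub> y) y) (supp k) \<oplus>\<^bsub>K\<^esub> finsum K (\<lambda>y. coeff_term h k (g \<otimes>\<^bsub>G\<^esub> inv\<^bsub>G\<^esub> y) y) (supp k)"
      using A g sub by (intro K.finsum_addf) (auto simp: Pi_def)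
    also have "\<dots> = (f \<otimes>\<^bsub>skew_ring\<^esub> k \<oplus>\<^bsub>skew_ring\<^esub> h \<otimes>\<^bsub>skew_ring\<^esub> k) g"
      unfolding skew_add_coeff[OF g] using A g by (simp add: skew_mult_coeff_right[OF _ _ g, of _ k "supp k"] sub subset_iff)
    finally show "((f \<oplus>\<^bsub>skew_ring\<^esub> h) \<otimes>\<^bsub>skew_ring\<^esub> k) g = (f \<otimes>\<^bsub>skew_ring\<^esub> k \<oplus>\<^bsub>skew_ring\<^esub> h \<otimes>\<^bsub>skew_ring\<^esub> k) g" .
  qed (simp_all add: A skew_add_closed skew_mult_closed)
  show "k \<otimes>\<^bsub>skew_ring\<^esub> (f \<oplus>\<^bsub>skew_ring\<^esub> h) = k \<otimes>\<^bsub>skew_ring\<^esub> f \<oplus>\<^bsub>skew_ring\<^esub> k \<otimes>\<^bsub>skew_ring\<^esub> h"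
  proof (rule skew_eqI)
    fix g assume g: "g \<in> carrier G"
    have "(k \<otimes>\<^bsub>skew_ring\<^esub> (f \<oplus>\<^bsub>skew_ring\<^esub> h)) g = finsum K (\<lambda>x. coeff_term k (f \<oplus>\<^bsub>skew_ring\<^esub> h) x (inv\<^bsub>G\<^esub> x \<otimes>\<^bsub>G\<^esub> g)) (supp k)"
      using A g by (intro skew_mult_coeff_left) (auto simp: skew_add_closed sub)
    also have "\<dots> = finsum K (\<lambda>x. coeff_term k f x (inv\<^bsub>G\<^esub> x \<otimes>\<^bsub>G\<^esub> g) \<oplus>\<^bsub>K\<^esub> coeff_term k h x (inv\<^bsub>G\<^esub> x \<otimes>\<^bsub>G\<^esub> g)) (supp k)"
      using A g sub by (intro K.finsum_cong') (auto simp: coeff_term_def skew_add_coeff K.l_distr K.r_distr)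
    also have "\<dots> = finsum K (\<lambda>x. coeff_term k f x (inv\<^bsub>G\<^esub> x \<otimes>\<^bsub>G\<^esub> g)) (supp k) \<oplus>\<^bsub>K\<^esub> finsum K (\<lambda>x. coeff_term k h x (inv\<^bsub>G\<^esub> x \<otimes>\<^bsub>G\<^esub> g)) (supp k)"
      using A g sub by (intro K.finsum_addf) (auto simp: Pi_def)
    also have "\<dots> = (k \<otimes>\<^bsub>skew_ring\<^esub> f \<oplus>\<^bsub>skew_ring\<^esub> k \<otimes>\<^bsub>skew_ring\<^esub> h) g"
      unfolding skew_add_coeff[OF g] using A g by (simp add: skew_mult_coeff_left[OF _ _ g, of k _ "supp k"] sub subset_iff)
    finally show "(k \<otimes>\<^bsub>skew_ring\<^esub> (f \<oplus>\<^bsub>skew_ring\<^esub> h)) g = (k \<otimes>\<^bsub>skew_ring\<^esub> f \<oplus>\<^bsub>skew_ring\<^esub> k \<otimes>\<^bsub>skew_ring\<^esub> h) g" .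
  qed (simp_all add: A skew_add_closed skew_mult_closed)
qed

lemma skew_mult_basis:
  assumes "x \<in> carrier G" "y \<in> carrier G" "a \<in> carrier K" "b \<in> carrier K"
  defines "single \<equiv> \<lambda>c z. \<lambda>g \<in> carrier G. if g = z then c else \<zero>\<^bsub>K\<^esub>"
  shows "single a x \<in> carrier skew_ring"
    and "single a x \<otimes>\<^bsub>skew_ring\<^esub> single b y
      = single (a \<otimes>\<^bsub>K\<^esub> \<sigma> x b \<otimes>\<^bsub>K\<^esub> \<alpha> x y) (x \<otimes>\<^bsub>G\<^esub> y)"
proof -
  have cl: "single c z \<in> carrier skew_ring" if "c \<in> carrier K" for c z
  proof -
    have "supp (single c z) \<subseteq> {z}" by (auto simp: coeff_support_def single_def split: if_splits)
    then have "finite (supp (single c z))" by (rule finite_subset) simp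
    then show ?thesis using that by (auto simp: skew_carrier single_def)
  qed
  then show "single a x \<in> carrier skew_ring" using assms by simp
  show "single a x \<otimes>\<^bsub>skew_ring\<^esub> single b y
      = single (a \<otimes>\<^bsub>K\<^esub> \<sigma> x b \<otimes>\<^bsub>K\<^esub> \<alpha> x y) (x \<otimes>\<^bsub>G\<^esub> y)"
  proof (rule skew_eqI)
    fix g assume g: "g \<in> carrier G"
    have "(single a x \<otimes>\<^bsub>skew_ring\<^esub> single b y) g
        = finsum K (\<lambda>z. coeff_term (single a x) (single b y) z (inv\<^bsub>G\<^esub> z \<otimes>\<^bsub>G\<^esub> g)) {x}"
      using assms(1-4) g cl
      by (intro skew_mult_coeff_left) (auto simp: coeff_support_def single_def split: if_splits)
    also have "\<dots> = coeff_term (single a x) (single b y) x (inv\<^bsub>G\<^esub> x \<otimes>\<^bsub>G\<^esub> g)"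
      using assms(1-4) g cl by simp
    also have "\<dots> = single (a \<otimes>\<^bsub>K\<^esub> \<sigma> x b \<otimes>\<^bsub>K\<^esub> \<alpha> x y) (x \<otimes>\<^bsub>G\<^esub> y) g"
    proof (cases "g = x \<otimes>\<^bsub>G\<^esub> y")
      case True
      then have "inv\<^bsub>G\<^esub> x \<otimes>\<^bsub>G\<^esub> g = y" using assms(1,2) by (simp add: G.m_assoc[symmetric])
      then show ?thesis using True assms(1-4) g by (simp add: coeff_term_def single_def)
    next
      case False
      then have "inv\<^bsub>G\<^esub> x \<otimes>\<^bsub>G\<^esub> g \<noteq> y" using assms(1,2) g by (metis G.inv_solve_left')
      then show ?thesis using False assms(1-4) g by (simp add: coeff_term_def single_def)
    qed
    finally show "(single a x \<otimes>\<^bsub>skew_ring\<^esub> single b y) g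
        = single (a \<otimes>\<^bsub>K\<^esub> \<sigma> x b \<otimes>\<^bsub>K\<^esub> \<alpha> x y) (x \<otimes>\<^bsub>G\<^esub> y) g" .
  qed (use assms(1-4) cl in \<open>auto intro!: skew_mult_closed\<close>)
qed

declare skew_coeff [simp del] skew_finite_supp [simp del] alpha_simps [simp del]
  sigma_closed [simp del] sigma_simps [simp del] coeff_term_closed [simp del]

end

end

theory Submission
  imports Defs
begin

text \<open>
  Let \<open>A\<close> be the twisted skew group ring, \<open>N\<close> the normal \<open>p\<close>-complement and \<open>s\<close> a generator of a Sylow
  \<open>p\<close>-subgroup, so that every element of \<open>G\<close> is some \<open>n s\<^sup>i\<close> with \<open>n \<in> N\<close>. By Maschke's argument every left
  ideal of the subring \<open>B\<close> supported on \<open>N\<close> is generated by an idempotent. Filtering a left ideal of \<open>A\<close>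
  by the exponents of \<open>s\<close> that occur, the \<open>N\<close>-parts form an increasing chain of left ideals of \<open>B\<close>, and
  orthogonal idempotents generating the successive steps lift to summands of a single generator: every
  left ideal of \<open>A\<close> is principal.

  The coefficient at the identity is a nondegenerate trace, so a right ideal \<open>I\<close> is the right
  annihilator of its left annihilator. If the latter is \<open>A v\<close>, then \<open>I = Ann\<^sub>r(v)\<close>.
\<close>

subsection \<open>Linear projections\<close>

text \<open>The prime p may divide |G|, so Maschke's argument is available for B but not for A. What
  replaces it on the p-part is a single unit: an element of a left ideal whose N-part vanishes is
  moved one exponent down by the inverse of the basis element of s, and it stays in the left ideal.
  This needs that one s suffices and that N is normal, because s^-1 n s^i = (s^-1 n s) s^(i-1) for i
  > 0. If \<sigma> is nontrivial, scalars are not central, so A is not a K-algebra through them and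
  left multiplication by a basis element is only semilinear. Linearity therefore has a side:
  averaging starts from a projection linear for scalars acting on the left, while the double
  annihilator argument uses functionals linear for scalars acting on the right. Finiteness of A
  replaces two pieces of linear algebra: complements come from maximality instead of bases, and |N|
  is inverted by an integer modulo |A| instead of inside K.\<close>

lemma (in module) submodule_zero:
  assumes "submodule H R M"
  shows "\<zero>\<^bsub>M\<^esub> \<in> H"
  using subgroup.one_closed[OF submodule.axioms(1)[OF assms]] by simp

text \<open>A submodule W maximal among those meeting U trivially is a complement. If x escaped U +
  W, then W + Rx would still meet U trivially, because a nonzero coefficient of x could be inverted
  to express x through U and W.\<close>

lemma (in module) submodule_complement:
  assumes R: "field R" and fin: "finite (carrier M)" and U: "submodule U R M"
  obtains W where "submodule W R M" "U \<inter> W = {\<zero>\<^bsub>M\<^esub>}"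
    "\<And>x. x \<in> carrier M \<Longrightarrow> \<exists>u\<in>U. \<exists>w\<in>W. x = u \<oplus>\<^bsub>M\<^esub> w"
proof -
  note Um = submoduleE[OF U] submodule_zero[OF U]
  define \<W> where "\<W> = {W. submodule W R M \<and> U \<inter> W = {\<zero>\<^bsub>M\<^esub>}}"
  have "{\<zero>\<^bsub>M\<^esub>} \<in> \<W>"
    using Um by (auto simp: \<W>_def intro!: submoduleI)
  moreover have "finite \<W>"
    by (rule finite_subset[of _ "Pow (carrier M)"]) (use fin in \<open>auto simp: \<W>_def dest: submoduleE(1)\<close>)
  ultimately obtain W where W: "W \<in> \<W>" and max: "\<And>V. V \<in> \<W> \<Longrightarrow> W \<subseteq> V \<Longrightarrow> V = W"
    using finite_has_maximal[of \<W>] by blast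
  have sW: "submodule W R M" and UW: "U \<inter> W = {\<zero>\<^bsub>M\<^esub>}" using W by (auto simp: \<W>_def)
  note Wm = submoduleE[OF sW] submodule_zero[OF sW]
  have "\<exists>u\<in>U. \<exists>w\<in>W. x = u \<oplus>\<^bsub>M\<^esub> w" if x: "x \<in> carrier M" for x
  proof (rule ccontr)
    assume no: "\<not> ?thesis"
    define V where "V = {w \<oplus>\<^bsub>M\<^esub> a \<odot>\<^bsub>M\<^esub> x | w a. w \<in> W \<and> a \<in> carrier R}"
    have VI: "w \<oplus>\<^bsub>M\<^esub> a \<odot>\<^bsub>M\<^esub> x \<in> V" if "w \<in> W" "a \<in> carrier R" for w a
      using that by (auto simp: V_def)
    have "submodule V R M"
    proof (rule submoduleI)
      show "V \<subseteq> carrier M" using x Wm(1) by (auto simp: V_def)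
      show "\<zero>\<^bsub>M\<^esub> \<in> V" using VI[of "\<zero>\<^bsub>M\<^esub>" "\<zero>"] Wm x by simp
    next
      fix v assume "v \<in> V"
      then obtain w a where v: "v = w \<oplus>\<^bsub>M\<^esub> a \<odot>\<^bsub>M\<^esub> x" "w \<in> W" "a \<in> carrier R" by (auto simp: V_def)
      have "\<ominus>\<^bsub>M\<^esub> v = \<ominus>\<^bsub>M\<^esub> w \<oplus>\<^bsub>M\<^esub> (\<ominus> a) \<odot>\<^bsub>M\<^esub> x"
        using v x Wm(1) by (auto simp: M.minus_add smult_l_minus)
      then show "\<ominus>\<^bsub>M\<^esub> v \<in> V" using v Wm by (auto intro!: VI)
    next
      fix v v' assume "v \<in> V" "v' \<in> V"
      then obtain w a w' a' where v: "v = w \<oplus>\<^bsub>M\<^esub> a \<odot>\<^bsub>M\<^esub> x" "w \<in> W" "a \<in> carrier R"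
        "v' = w' \<oplus>\<^bsub>M\<^esub> a' \<odot>\<^bsub>M\<^esub> x" "w' \<in> W" "a' \<in> carrier R" unfolding V_def by blast
      then have "w \<in> carrier M" "w' \<in> carrier M" using Wm(1) by auto
      then have "v \<oplus>\<^bsub>M\<^esub> v' = (w \<oplus>\<^bsub>M\<^esub> w') \<oplus>\<^bsub>M\<^esub> (a \<oplus> a') \<odot>\<^bsub>M\<^esub> x"
        using v x by (simp add: smult_l_distr M.a_ac)
      then show "v \<oplus>\<^bsub>M\<^esub> v' \<in> V" using v Wm by (auto intro!: VI)
    next
      fix b v assume b: "b \<in> carrier R" and "v \<in> V"
      then obtain w a where v: "v = w \<oplus>\<^bsub>M\<^esub> a \<odot>\<^bsub>M\<^esub> x" "w \<in> W" "a \<in> carrier R" by (auto simp: V_def)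
      then have "w \<in> carrier M" using Wm(1) by auto
      then have "b \<odot>\<^bsub>M\<^esub> v = b \<odot>\<^bsub>M\<^esub> w \<oplus>\<^bsub>M\<^esub> (b \<otimes> a) \<odot>\<^bsub>M\<^esub> x"
        using v x b by (simp add: smult_r_distr smult_assoc1)
      then show "b \<odot>\<^bsub>M\<^esub> v \<in> V" using v b Wm by (auto intro!: VI)
    qed
    moreover have "U \<inter> V = {\<zero>\<^bsub>M\<^esub>}"
    proof (intro equalityI subsetI)
      fix u assume u: "u \<in> U \<inter> V"
      then obtain w a where v: "u = w \<oplus>\<^bsub>M\<^esub> a \<odot>\<^bsub>M\<^esub> x" "w \<in> W" "a \<in> carrier R" by (auto simp: V_def)
      have wM: "w \<in> carrier M" and uM: "u \<in> carrier M" using u v Wm(1) Um(1) by auto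
      show "u \<in> {\<zero>\<^bsub>M\<^esub>}"
      proof (cases "a = \<zero>")
        case True
        then have "u = w" using v x wM by simp
        then show ?thesis using u v UW by auto
      next
        case False
        then have a: "a \<in> Units R" using v R by (simp add: field.field_Units)
        have "a \<odot>\<^bsub>M\<^esub> x = u \<oplus>\<^bsub>M\<^esub> \<ominus>\<^bsub>M\<^esub> w" using v x wM by (simp add: M.a_ac M.r_neg2)
        then have "inv a \<odot>\<^bsub>M\<^esub> (a \<odot>\<^bsub>M\<^esub> x) = inv a \<odot>\<^bsub>M\<^esub> u \<oplus>\<^bsub>M\<^esub> inv a \<odot>\<^bsub>M\<^esub> (\<ominus>\<^bsub>M\<^esub> w)"
          using a wM uM by (simp add: smult_r_distr)
        moreover have "inv a \<odot>\<^bsub>M\<^esub> (a \<odot>\<^bsub>M\<^esub> x) = x"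
          using a x v by (simp flip: smult_assoc1)
        ultimately have "x = inv a \<odot>\<^bsub>M\<^esub> u \<oplus>\<^bsub>M\<^esub> inv a \<odot>\<^bsub>M\<^esub> (\<ominus>\<^bsub>M\<^esub> w)" by simp
        then show ?thesis using no a u v Wm Um by (metis IntD1 R.Units_inv_closed)
      qed
    next
      fix u assume "u \<in> {\<zero>\<^bsub>M\<^esub>}"
      then show "u \<in> U \<inter> V" using VI[of "\<zero>\<^bsub>M\<^esub>" "\<zero>"] Wm Um x by simp
    qed
    ultimately have "V \<in> \<W>" by (simp add: \<W>_def)
    moreover have "W \<subseteq> V"
    proof
      fix w assume "w \<in> W"
      then show "w \<in> V" using VI[of w "\<zero>"] x Wm(1) by auto
    qed
    ultimately have "V = W" by (rule max)
    moreover have "x \<in> V" using VI[of "\<zero>\<^bsub>M\<^esub>" "\<one>"] Wm x by simp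
    ultimately show False using no Um Wm x by (metis M.l_zero)
  qed
  then show ?thesis using that sW UW by blast
qed

lemma (in module) submodule_projection:
  assumes "field R" and "finite (carrier M)" and U: "submodule U R M"
  obtains \<pi> where "\<pi> \<in> carrier M \<rightarrow> U" "\<And>u. u \<in> U \<Longrightarrow> \<pi> u = u"
    "\<And>x y. \<lbrakk>x \<in> carrier M; y \<in> carrier M\<rbrakk> \<Longrightarrow> \<pi> (x \<oplus>\<^bsub>M\<^esub> y) = \<pi> x \<oplus>\<^bsub>M\<^esub> \<pi> y"
    "\<And>a x. \<lbrakk>a \<in> carrier R; x \<in> carrier M\<rbrakk> \<Longrightarrow> \<pi> (a \<odot>\<^bsub>M\<^esub> x) = a \<odot>\<^bsub>M\<^esub> \<pi> x"
proof -
  obtain W where W: "submodule W R M" and UW: "U \<inter> W = {\<zero>\<^bsub>M\<^esub>}"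
    and sum: "\<And>x. x \<in> carrier M \<Longrightarrow> \<exists>u\<in>U. \<exists>w\<in>W. x = u \<oplus>\<^bsub>M\<^esub> w"
    using submodule_complement[OF assms] by blast
  note Um = submoduleE[OF U] submodule_zero[OF U]
  note Wm = submoduleE[OF W] submodule_zero[OF W]
  have uniq: "u = u'" if "u \<in> U" "u' \<in> U" "w \<in> W" "w' \<in> W" "u \<oplus>\<^bsub>M\<^esub> w = u' \<oplus>\<^bsub>M\<^esub> w'" for u u' w w'
  proof -
    have c: "u \<in> carrier M" "u' \<in> carrier M" "w \<in> carrier M" "w' \<in> carrier M" using that Um Wm by auto
    have "u \<oplus>\<^bsub>M\<^esub> \<ominus>\<^bsub>M\<^esub> u' = (u \<oplus>\<^bsub>M\<^esub> w) \<oplus>\<^bsub>M\<^esub> \<ominus>\<^bsub>M\<^esub> w \<oplus>\<^bsub>M\<^esub> \<ominus>\<^bsub>M\<^esub> u'"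
      using c by (simp add: M.a_assoc M.r_neg)
    also have "\<dots> = w' \<oplus>\<^bsub>M\<^esub> \<ominus>\<^bsub>M\<^esub> w \<oplus>\<^bsub>M\<^esub> (u' \<oplus>\<^bsub>M\<^esub> \<ominus>\<^bsub>M\<^esub> u')"
      unfolding that(5) using c by (simp add: M.a_ac)
    also have "\<dots> = w' \<oplus>\<^bsub>M\<^esub> \<ominus>\<^bsub>M\<^esub> w" using c by (simp add: M.r_neg)
    finally have "u \<oplus>\<^bsub>M\<^esub> \<ominus>\<^bsub>M\<^esub> u' \<in> U \<inter> W" using that Um Wm by (metis IntI)
    then have "u \<oplus>\<^bsub>M\<^esub> \<ominus>\<^bsub>M\<^esub> u' = \<zero>\<^bsub>M\<^esub>" using UW by auto
    then show ?thesis using c by (metis M.minus_equality M.minus_minus M.add.inv_closed)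
  qed
  \<comment> \<open>By \<open>uniq\<close> the U-component is determined, so the choice is forced
    and inherits additivity and scalar compatibility from the decomposition.\<close>
  define \<pi> where "\<pi> x = (SOME u. u \<in> U \<and> (\<exists>w\<in>W. x = u \<oplus>\<^bsub>M\<^esub> w))" for x
  have \<pi>: "\<pi> x \<in> U \<and> (\<exists>w\<in>W. x = \<pi> x \<oplus>\<^bsub>M\<^esub> w)" if "x \<in> carrier M" for x
    unfolding \<pi>_def by (rule someI_ex) (use sum[OF that] in blast)
  have \<pi>I: "\<pi> x = u" if "x = u \<oplus>\<^bsub>M\<^esub> w" "u \<in> U" "w \<in> W" for x u w
    using \<pi>[of x] uniq that Um(1) Wm(1) by (metis M.add.m_closed subsetD)
  show ?thesis
  proof (rule that[of \<pi>])
    show "\<pi> \<in> carrier M \<rightarrow> U" using \<pi> by blast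
    show "\<pi> u = u" if "u \<in> U" for u using that Um(1) Wm by (intro \<pi>I[of _ _ "\<zero>\<^bsub>M\<^esub>"]) auto
  next
    fix x y assume xy: "x \<in> carrier M" "y \<in> carrier M"
    obtain w v where w: "w \<in> W" "x = \<pi> x \<oplus>\<^bsub>M\<^esub> w" and v: "v \<in> W" "y = \<pi> y \<oplus>\<^bsub>M\<^esub> v" using \<pi> xy by blast
    have c: "\<pi> x \<in> carrier M" "\<pi> y \<in> carrier M" "w \<in> carrier M" "v \<in> carrier M"
      using \<pi> xy w v Um(1) Wm(1) by auto
    have "x \<oplus>\<^bsub>M\<^esub> y = (\<pi> x \<oplus>\<^bsub>M\<^esub> w) \<oplus>\<^bsub>M\<^esub> (\<pi> y \<oplus>\<^bsub>M\<^esub> v)" using w v by simp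
    also have "\<dots> = (\<pi> x \<oplus>\<^bsub>M\<^esub> \<pi> y) \<oplus>\<^bsub>M\<^esub> (w \<oplus>\<^bsub>M\<^esub> v)" using c by (simp add: M.a_ac)
    finally show "\<pi> (x \<oplus>\<^bsub>M\<^esub> y) = \<pi> x \<oplus>\<^bsub>M\<^esub> \<pi> y" using \<pi> xy Um Wm w v by (intro \<pi>I[of _ _ "w \<oplus>\<^bsub>M\<^esub> v"]) auto
  next
    fix a x assume ax: "a \<in> carrier R" "x \<in> carrier M"
    obtain w where w: "w \<in> W" "x = \<pi> x \<oplus>\<^bsub>M\<^esub> w" using \<pi> ax by blast
    have c: "\<pi> x \<in> carrier M" "w \<in> carrier M" using \<pi> ax w Um(1) Wm(1) by auto
    have "a \<odot>\<^bsub>M\<^esub> x = a \<odot>\<^bsub>M\<^esub> (\<pi> x \<oplus>\<^bsub>M\<^esub> w)" using w by simp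
    also have "\<dots> = a \<odot>\<^bsub>M\<^esub> \<pi> x \<oplus>\<^bsub>M\<^esub> a \<odot>\<^bsub>M\<^esub> w" using c ax by (simp add: smult_r_distr)
    finally show "\<pi> (a \<odot>\<^bsub>M\<^esub> x) = a \<odot>\<^bsub>M\<^esub> \<pi> x" using \<pi> ax Um Wm w by (intro \<pi>I[of _ _ "a \<odot>\<^bsub>M\<^esub> w"]) auto
  qed
qed

text \<open>The scalar action \<open>s\<close> is a parameter because scalars act differently from
  the two sides: Maschke's argument instantiates it by left multiplication, the separation of points
  from right ideals by right multiplication.\<close>

lemma (in abelian_group) action_projection:
  fixes K :: "('c, 'd) ring_scheme" (structure) and s :: "'c \<Rightarrow> 'a \<Rightarrow> 'a"
  assumes K: "field K" and fin: "finite (carrier G)"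
    and s_closed: "\<And>a x. a \<in> carrier K \<Longrightarrow> x \<in> carrier G \<Longrightarrow> s a x \<in> carrier G"
    and s_l: "\<And>a b x. a \<in> carrier K \<Longrightarrow> b \<in> carrier K \<Longrightarrow> x \<in> carrier G \<Longrightarrow>
      s (a \<oplus>\<^bsub>K\<^esub> b) x = s a x \<oplus>\<^bsub>G\<^esub> s b x"
    and s_r: "\<And>a x y. a \<in> carrier K \<Longrightarrow> x \<in> carrier G \<Longrightarrow> y \<in> carrier G \<Longrightarrow>
      s a (x \<oplus>\<^bsub>G\<^esub> y) = s a x \<oplus>\<^bsub>G\<^esub> s a y"
    and s_assoc: "\<And>a b x. a \<in> carrier K \<Longrightarrow> b \<in> carrier K \<Longrightarrow> x \<in> carrier G \<Longrightarrow>
      s (a \<otimes>\<^bsub>K\<^esub> b) x = s a (s b x)"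
    and s_one: "\<And>x. x \<in> carrier G \<Longrightarrow> s \<one>\<^bsub>K\<^esub> x = x"
    and U: "additive_subgroup U G" "\<And>a u. a \<in> carrier K \<Longrightarrow> u \<in> U \<Longrightarrow> s a u \<in> U"
  obtains \<pi> where "\<pi> \<in> carrier G \<rightarrow> U" "\<And>u. u \<in> U \<Longrightarrow> \<pi> u = u"
    "\<And>x y. \<lbrakk>x \<in> carrier G; y \<in> carrier G\<rbrakk> \<Longrightarrow> \<pi> (x \<oplus>\<^bsub>G\<^esub> y) = \<pi> x \<oplus>\<^bsub>G\<^esub> \<pi> y"
    "\<And>a x. \<lbrakk>a \<in> carrier K; x \<in> carrier G\<rbrakk> \<Longrightarrow> \<pi> (s a x) = s a (\<pi> x)"
proof -
  let ?M = "\<lparr>carrier = carrier G, monoid.mult = monoid.mult G, monoid.one = monoid.one G, ring.zero = ring.zero G,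
    ring.add = ring.add G, module.smult = s\<rparr>"
  have ab: "abelian_group ?M"
    by (rule abelian_groupI) (auto simp: a_ac intro: l_neg bexI[of _ "\<ominus>\<^bsub>G\<^esub> _"])
  interpret K: field K by (rule K)
  interpret M: module K ?M
    by (rule moduleI) (use ab K.is_cring in \<open>auto simp: s_closed s_l s_r s_assoc s_one\<close>)
  interpret U: additive_subgroup U G by (rule U(1))
  have "submodule U K ?M"
    using U U.a_subgroup unfolding submodule_def submodule_axioms_def
    by (simp add: subgroup_def m_inv_def)
  from M.submodule_projection[OF K _ this] fin that show ?thesis by auto
qed

subsection \<open>Groups with a normal p-complement and a cyclic Sylow subgroup\<close>

text \<open>Shows that the set of elements of order coprime to p is stable under conjugation, so
  once it is a subgroup it is normal.\<close>

lemma (in group) ord_conj: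
  assumes "x \<in> carrier G" "g \<in> carrier G"
  shows "ord (g \<otimes> x \<otimes> inv g) = ord x"
proof -
  have pow: "(g \<otimes> x \<otimes> inv g) [^] k = g \<otimes> x [^] k \<otimes> inv g" for k :: nat
  proof (induction k)
    case (Suc k)
    have "inv g \<otimes> (g \<otimes> y) = y" if "y \<in> carrier G" for y
      using assms that by (simp flip: m_assoc)
    then show ?case using Suc assms by (simp add: m_assoc)
  qed (use assms in simp)
  have "(g \<otimes> x \<otimes> inv g) [^] k = \<one> \<longleftrightarrow> x [^] k = \<one>" for k :: nat
  proof -
    have "g \<otimes> x [^] k \<otimes> inv g = \<one> \<longleftrightarrow> g \<otimes> x [^] k = g"
      using assms inv_solve_right[of \<one> "g \<otimes> x [^] k" "g"] 
      by (metis inv_closed inv_equality inv_inv l_one m_closed nat_pow_closed one_closed r_inv)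
    then show ?thesis unfolding pow using assms by (simp add: l_cancel_one)
  qed
  then show ?thesis using assms ord_unique[of "g \<otimes> x \<otimes> inv g" "ord x"] by (simp add: pow_eq_id)
qed

text \<open>The complement contains every Sylow subgroup for the other primes, which bounds its order from
  below; its trivial intersection with a Sylow \<open>p\<close>-subgroup bounds it from above.\<close>
lemma (in group) p_nilpotent_factorization:
  assumes p: "Factorial_Ring.prime p" and fin: "finite (carrier G)"
    and nil: "p_nilpotent p G" and P: "sylow_subgroup p P G"
  defines "N \<equiv> {x \<in> carrier G. coprime (ord x) p}"
  shows "coprime (card N) p" and "carrier G = N <#> P"
proof -
  have N: "subgroup N G" using nil by (simp add: p_nilpotent_def N_def)
  define a where "a = multiplicity p (order G)"
  have sP: "subgroup P G" and cP: "card P = p ^ a" using P by (auto simp: sylow_subgroup_def a_def)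
  have oG: "order G > 0" using fin by (simp add: order_gt_0_iff_finite)
  obtain m where m: "order G = p ^ a * m" "\<not> p dvd m"
    using multiplicity_decompose'[of "order G" p] p oG unfolding a_def
    by (metis not_prime_unit less_irrefl)
  have m0: "m > 0" using m oG by (cases m) auto
  have finN: "finite N" and finP: "finite P" using subgroup.subset[OF N] subgroup.subset[OF sP] fin
    by (auto intro: finite_subset)
  have cN: "card N > 0" using finN subgroup.one_closed[OF N] by (auto simp: card_gt_0_iff)
  \<comment> \<open>The order of x divides a power of p and is coprime to p.\<close>
  have trivial: "x = \<one>" if "x \<in> N" "x \<in> P" for x
  proof -
    have x: "x \<in> carrier G" "coprime (ord x) p" using that by (auto simp: N_def)
    have "x [^]\<^bsub>G\<lparr>carrier := P\<rparr>\<^esub> card P = \<one>"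
      using group.pow_order_eq_1[OF subgroup.subgroup_is_group[OF sP is_group], of x] that
      by (simp add: order_def)
    then have "x [^] card P = \<one>" by (simp add: nat_pow_def)
    then have "ord x dvd p ^ a" using x pow_eq_id cP by simp
    moreover have "coprime (ord x) (p ^ a)" using x by simp
    ultimately have "ord x = 1" by (metis coprime_absorb_left is_unit_gcd nat_dvd_1_iff_1)
    then show ?thesis using ord_eq_1[OF x(1)] by simp
  qed
  have inj: "inj_on (\<lambda>(n, q). n \<otimes> q) (N \<times> P)"
  proof (rule inj_onI, clarify)
    fix n q n' q' assume A: "n \<in> N" "q \<in> P" "n' \<in> N" "q' \<in> P" "n \<otimes> q = n' \<otimes> q'"
    have c: "n \<in> carrier G" "q \<in> carrier G" "n' \<in> carrier G" "q' \<in> carrier G"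
      using A subgroup.mem_carrier[OF N] subgroup.mem_carrier[OF sP] by auto
    have "inv n' \<otimes> n = inv n' \<otimes> (n \<otimes> q) \<otimes> inv q"
      using c by (simp add: m_assoc)
    also have "\<dots> = q' \<otimes> inv q" unfolding A(5) using c by (simp flip: m_assoc)
    finally have e: "inv n' \<otimes> n = q' \<otimes> inv q" .
    have "inv n' \<otimes> n \<in> N" "q' \<otimes> inv q \<in> P"
      using A N sP by (auto intro: subgroup.m_closed subgroup.m_inv_closed)
    then have "inv n' \<otimes> n = \<one>" using e trivial by metis
    then have "n = n'" using c by (metis inv_equality inv_inv inv_closed)
    then show "n = n' \<and> q = q'" using A(5) c by simp
  qed
  have img: "(\<lambda>(n, q). n \<otimes> q) ` (N \<times> P) = N <#> P" by (auto simp: set_mult_def)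
  have sub: "N <#> P \<subseteq> carrier G" using N sP by (simp add: set_mult_closed subgroup.subset)
  have card: "card (N <#> P) = card N * p ^ a"
    using card_image[OF inj] unfolding img by (simp add: card_cartesian_product cP)
  have "card N * p ^ a \<le> p ^ a * m" using card_mono[OF fin sub] card m by (simp add: order_def)
  then have le: "card N \<le> m" using p by (simp add: mult.commute prime_gt_0_nat)
  have "m dvd card N"
  proof (rule multiplicity_le_imp_dvd)
    fix q :: nat assume q: "Factorial_Ring.prime q"
    show "multiplicity q m \<le> multiplicity q (card N)"
    proof (cases "q = p")
      case True
      then show ?thesis using m by (simp add: not_dvd_imp_multiplicity_0)
    next
      case False
      obtain r where "order G = q ^ multiplicity q m * r"
        using m multiplicity_dvd[of q m] by (metis dvd_def mult.left_commute)
      then obtain Q where Q: "subgroup Q G" "card Q = q ^ multiplicity q m"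
        using sylow_thm[OF q is_group _ fin] by blast
      have "Q \<subseteq> N"
      proof
        fix x assume x: "x \<in> Q"
        then have xG: "x \<in> carrier G" using subgroup.mem_carrier[OF Q(1)] by blast
        have "x [^]\<^bsub>G\<lparr>carrier := Q\<rparr>\<^esub> card Q = \<one>"
          using group.pow_order_eq_1[OF subgroup.subgroup_is_group[OF Q(1) is_group], of x] x
          by (simp add: order_def)
        then have "x [^] card Q = \<one>" by (simp add: nat_pow_def)
        then have "ord x dvd q ^ multiplicity q m" using xG pow_eq_id Q by simp
        moreover have "coprime (q ^ multiplicity q m) p" using False p q by (simp add: primes_coprime)
        ultimately have "coprime (ord x) p" by (rule coprime_divisors[OF _ dvd_refl])
        then show "x \<in> N" using xG by (simp add: N_def)
      qed
      then have "subgroup Q (G\<lparr>carrier := N\<rparr>)" using subgroup_incl[OF Q(1) N] by simp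
      then have "card (rcosets\<^bsub>G\<lparr>carrier := N\<rparr>\<^esub> Q) * card Q = card N"
        using group.lagrange[OF subgroup.subgroup_is_group[OF N is_group], of Q] by (simp add: order_def)
      then have "card Q dvd card N" by (metis dvd_triv_right)
      then show ?thesis using Q cN q by (intro multiplicity_geI) (auto dest: not_prime_unit)
    qed
  qed (use m0 in simp)
  then have eq: "card N = m" using le cN by (simp add: dvd_imp_le le_antisym)
  show "coprime (card N) p" using eq prime_imp_coprime[OF p m(2)] by (simp add: coprime_commute)
  have "card (N <#> P) = card (carrier G)"
    unfolding card eq using m(1) by (simp only: order_def mult.commute)
  then show "carrier G = N <#> P" using card_subset_eq[OF fin sub] by simp
qed

text \<open>The exponents are natural numbers so that they can index a filtration starting from
  zero; an integer power of s becomes one by reduction modulo the order of s.\<close>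

lemma (in group) p_nilpotent_cyclic_sylow:
  assumes "Factorial_Ring.prime p" and "finite (carrier G)"
    and "p_nilpotent p G" and P: "sylow_subgroup p P G" and cyc: "cyclic_group (G\<lparr>carrier := P\<rparr>)"
  defines "N \<equiv> {x \<in> carrier G. coprime (ord x) p}"
  obtains s where "s \<in> carrier G" "\<And>g. g \<in> carrier G \<Longrightarrow> \<exists>n\<in>N. \<exists>i::nat. g = n \<otimes> s [^] i"
proof -
  have sP: "subgroup P G" using P by (simp add: sylow_subgroup_def)
  interpret P: group "G\<lparr>carrier := P\<rparr>" by (rule subgroup.subgroup_is_group[OF sP is_group])
  obtain s where s: "s \<in> P" "P = range (\<lambda>n::int. s [^]\<^bsub>G\<lparr>carrier := P\<rparr>\<^esub> n)"
    using cyc unfolding P.cyclic_group by auto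
  have sG: "s \<in> carrier G" using s subgroup.mem_carrier[OF sP] by blast
  have "\<exists>i::nat. q = s [^] i" if "q \<in> P" for q
  proof -
    have "ord s > 0" using ord_ge_1[OF assms(2) sG] by simp
    have "q \<in> range (\<lambda>n::int. s [^]\<^bsub>G\<lparr>carrier := P\<rparr>\<^esub> n)"
      using that by (simp only: s(2)[symmetric])
    then obtain k :: int where k: "q = s [^] k"
      using int_pow_consistent[OF sP s(1)] by auto
    have "s [^] (k mod int (ord s)) = s [^] k"
      using sG int_pow_eq[of s] by (simp add: mod_eq_dvd_iff)
    moreover have "k mod int (ord s) = int (nat (k mod int (ord s)))" using \<open>ord s > 0\<close> by simp
    ultimately have "q = s [^] nat (k mod int (ord s))" using k by (metis int_pow_int)
    then show ?thesis by blast
  qed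
  moreover have "carrier G = N <#> P"
    unfolding N_def by (rule p_nilpotent_factorization(2)[OF assms(1-4)])
  ultimately have "\<exists>n\<in>N. \<exists>i::nat. g = n \<otimes> s [^] i" if "g \<in> carrier G" for g
    using that unfolding set_mult_def by blast
  then show ?thesis using that sG by blast
qed

subsection \<open>Principal left ideals from a filtration\<close>

text \<open>The acting set \<open>B\<close> is separate from the ring, so one notion covers left
  ideals of R (\<open>B = carrier R\<close>), left ideals of a subring
  (\<open>M \<subseteq> B\<close>), and the steps of the filtration, which are only modules over the
  subring.\<close>

definition left_submodule :: "'a set \<Rightarrow> 'a set \<Rightarrow> ('a, 'b) ring_scheme \<Rightarrow> bool" where
  "left_submodule B M R \<longleftrightarrow> additive_subgroup M R \<and> (\<forall>b\<in>B. \<forall>x\<in>M. b \<otimes>\<^bsub>R\<^esub> x \<in> M)"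

context ring
begin

lemma left_submoduleD:
  assumes "left_submodule B M R"
  shows "M \<subseteq> carrier R" "\<zero> \<in> M" "\<And>x y. x \<in> M \<Longrightarrow> y \<in> M \<Longrightarrow> x \<oplus> y \<in> M"
    "\<And>x. x \<in> M \<Longrightarrow> \<ominus> x \<in> M" "\<And>x y. x \<in> M \<Longrightarrow> y \<in> M \<Longrightarrow> x \<ominus> y \<in> M"
    "\<And>b x. b \<in> B \<Longrightarrow> x \<in> M \<Longrightarrow> b \<otimes> x \<in> M"
proof -
  interpret additive_subgroup M R using assms by (simp add: left_submodule_def)
  show "M \<subseteq> carrier R" "\<zero> \<in> M" "\<And>x y. x \<in> M \<Longrightarrow> y \<in> M \<Longrightarrow> x \<oplus> y \<in> M"
    "\<And>x. x \<in> M \<Longrightarrow> \<ominus> x \<in> M" "\<And>x y. x \<in> M \<Longrightarrow> y \<in> M \<Longrightarrow> x \<ominus> y \<in> M"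
    using a_subset abelian_group_axioms by (auto simp: a_minus_def)
  show "\<And>b x. b \<in> B \<Longrightarrow> x \<in> M \<Longrightarrow> b \<otimes> x \<in> M" using assms by (simp add: left_submodule_def)
qed

lemma left_submoduleI:
  assumes "M \<subseteq> carrier R" "\<zero> \<in> M" "\<And>x y. x \<in> M \<Longrightarrow> y \<in> M \<Longrightarrow> x \<oplus> y \<in> M"
    "\<And>x. x \<in> M \<Longrightarrow> \<ominus> x \<in> M" "\<And>b x. b \<in> B \<Longrightarrow> x \<in> M \<Longrightarrow> b \<otimes> x \<in> M"
  shows "left_submodule B M R"
  using assms unfolding left_submodule_def
  by (auto intro!: additive_subgroup.intro subgroup.intro simp flip: a_inv_def)

lemma left_submodule_Int:
  assumes "left_submodule B M R" "left_submodule C N R" "B \<subseteq> C"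
  shows "left_submodule B (M \<inter> N) R"
  using left_submoduleD[OF assms(1)] left_submoduleD[OF assms(2)] assms(3)
  by (intro left_submoduleI) auto

text \<open>Along the filtration, the left ideals \<open>\<rho> ` (L \<inter> S k)\<close> of \<open>B\<close> increase, so they are generated by
  growing sums of orthogonal idempotents. Lifting each new idempotent \<open>d\<close> to \<open>h \<in> L\<close> with \<open>d h = h\<close>,
  the sum of the lifts generates everything, since multiplying it by \<open>d\<close> recovers \<open>h\<close>.\<close>
lemma left_ideal_principal_of_filtration:
  assumes B: "subring B R"
    and semisimple: "\<And>M. M \<subseteq> B \<Longrightarrow> left_submodule B M R \<Longrightarrow> \<exists>e\<in>M. \<forall>x\<in>M. x \<otimes> e = x"
    and rho_closed: "\<And>x. x \<in> carrier R \<Longrightarrow> \<rho> x \<in> B"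
    and rho_add: "\<And>x y. x \<in> carrier R \<Longrightarrow> y \<in> carrier R \<Longrightarrow> \<rho> (x \<oplus> y) = \<rho> x \<oplus> \<rho> y"
    and rho_mult: "\<And>b x. b \<in> B \<Longrightarrow> x \<in> carrier R \<Longrightarrow> \<rho> (b \<otimes> x) = b \<otimes> \<rho> x"
    and S: "\<And>k. left_submodule B (S k) R"
    and S_0: "S 0 = {\<zero>}" and S_mono: "\<And>k. S k \<subseteq> S (Suc k)"
    and tt: "t \<in> carrier R" "t' \<in> carrier R" "t' \<otimes> t = \<one>"
    and S_shift: "\<And>k x. x \<in> S (Suc k) \<Longrightarrow> \<rho> x = \<zero> \<Longrightarrow> t \<otimes> x \<in> S k"
    and L: "left_submodule (carrier R) L R"
  shows "\<exists>f\<in>L. \<forall>x\<in>L \<inter> S k. \<exists>a\<in>carrier R. x = a \<otimes> f"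
proof -
  have Bc: "B \<subseteq> carrier R" and B0: "\<zero> \<in> B"
    and Bm: "\<And>b c. b \<in> B \<Longrightarrow> c \<in> B \<Longrightarrow> b \<otimes> c \<in> B"
    and Ba: "\<And>b c. b \<in> B \<Longrightarrow> c \<in> B \<Longrightarrow> b \<oplus> c \<in> B"
    and Bi: "\<And>b. b \<in> B \<Longrightarrow> \<ominus> b \<in> B"
    using subringE[OF B] by auto
  note Lm = left_submoduleD[OF L] and Sm = left_submoduleD[OF S]
  have rho0: "\<rho> \<zero> = \<zero>" using rho_mult[of \<zero> \<zero>] B0 rho_closed[of \<zero>] Bc by (simp add: subset_iff)
  have LSm: "left_submodule B (L \<inter> S k) R" for k
    using left_submodule_Int[OF S L Bc] by (simp add: Int_commute)
  have rho_neg: "\<rho> (\<ominus> x) = \<ominus> \<rho> x" if "x \<in> carrier R" for x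
    using that rho_add[of x "\<ominus> x"] rho_closed[of x] rho_closed[of "\<ominus> x"] Bc
    by (metis a_inv_closed minus_equality r_neg rho0 subsetD a_comm)
  \<comment> \<open>The claim is strengthened for the induction:
    \<open>\<rho> x \<otimes> e = \<rho> x\<close> says that e generates the image of
    \<open>L \<inter> S k\<close>, and \<open>e \<otimes> f = f\<close> lets e extract f from a
    larger sum.\<close>
  have "\<exists>f\<in>L \<inter> S k. \<exists>e\<in>B. \<rho> f = e \<and> e \<otimes> e = e \<and> e \<otimes> f = f \<and>
      (\<forall>x\<in>L \<inter> S k. \<rho> x \<otimes> e = \<rho> x \<and> (\<exists>a\<in>carrier R. x = a \<otimes> f))"
  proof (induction k)
    case 0
    have "L \<inter> S 0 = {\<zero>}" using S_0 Lm by auto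
    then show ?case using B0 rho0 by auto
  next
    case (Suc k)
    then obtain f e where f: "f \<in> L" "f \<in> S k" and e: "e \<in> B" "\<rho> f = e" "e \<otimes> e = e" "e \<otimes> f = f"
      and IH: "\<And>x. x \<in> L \<Longrightarrow> x \<in> S k \<Longrightarrow> \<rho> x \<otimes> e = \<rho> x \<and> (\<exists>a\<in>carrier R. x = a \<otimes> f)"
      by blast
    define M where "M = \<rho> ` (L \<inter> S (Suc k))"
    note LS = left_submoduleD[OF LSm[of "Suc k"]]
    have M: "left_submodule B M R"
      unfolding M_def
    proof (rule left_submoduleI)
      show "\<rho> ` (L \<inter> S (Suc k)) \<subseteq> carrier R" using rho_closed LS(1) Bc by blast
      show "\<zero> \<in> \<rho> ` (L \<inter> S (Suc k))" using rho0 LS(2) by force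
    next
      fix x assume "x \<in> \<rho> ` (L \<inter> S (Suc k))"
      then obtain y where y: "y \<in> L \<inter> S (Suc k)" "x = \<rho> y" by blast
      then show "\<ominus> x \<in> \<rho> ` (L \<inter> S (Suc k))"
        using rho_neg[of y] LS(1) LS(4)[OF y(1)] by (metis imageI subsetD)
      fix b assume "b \<in> B"
      then show "b \<otimes> x \<in> \<rho> ` (L \<inter> S (Suc k))"
        using rho_mult[of b y] y LS(1) LS(6)[of b y] by (metis imageI subsetD)
    next
      fix x x' assume "x \<in> \<rho> ` (L \<inter> S (Suc k))" "x' \<in> \<rho> ` (L \<inter> S (Suc k))"
      then obtain y y' where y: "y \<in> L \<inter> S (Suc k)" "x = \<rho> y" "y' \<in> L \<inter> S (Suc k)" "x' = \<rho> y'" by blast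
      then show "x \<oplus> x' \<in> \<rho> ` (L \<inter> S (Suc k))"
        using rho_add[of y y'] LS(1) LS(3)[of y y'] by (metis imageI subsetD)
    qed
    have MB: "M \<subseteq> B" using rho_closed LS(1) by (auto simp: M_def)
    note Mm = left_submoduleD[OF M]
    have eM: "e \<in> M" using f e S_mono[of k] by (auto simp: M_def)
    \<comment> \<open>Peirce decomposition: writing m as m e + (m - m e) splits M into the part
      generated by the old idempotent and \<open>M'\<close>, the part that is new at this
      step.\<close>
    define M' where "M' = {m \<in> M. m \<otimes> e = \<zero>}"
    have M': "left_submodule B M' R"
      using Mm e(1) Bc unfolding M'_def
      by (intro left_submoduleI) (auto simp: l_distr l_minus m_assoc subset_iff)
    then obtain g where g: "g \<in> M'" "\<And>m. m \<in> M' \<Longrightarrow> m \<otimes> g = m"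
      using semisimple[OF _ M'] MB by (auto simp: M'_def)
    have eC: "e \<in> carrier R" and gC: "g \<in> carrier R" using e g Bc left_submoduleD(1)[OF M'] by auto
    \<comment> \<open>From \<open>g \<in> M'\<close> only g e = 0 is known, while e g may be
      nonzero. Subtracting e g makes the idempotents orthogonal on both sides, and right
      multiplication by d is still the identity on \<open>M'\<close>, since m e = 0 there.\<close>
    define d where "d = g \<ominus> e \<otimes> g"
    have gM': "g \<in> M" "g \<otimes> e = \<zero>" using g by (auto simp: M'_def)
    have dM: "d \<in> M'"
      using left_submoduleD(5,6)[OF M'] g(1) e(1) by (auto simp: d_def)
    then have dC: "d \<in> carrier R" and dB: "d \<in> B" and dM2: "d \<in> M" and de: "d \<otimes> e = \<zero>"
      using Bc MB by (auto simp: M'_def)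
    have ed: "e \<otimes> d = \<zero>"
      using eC gC e(3) by (simp add: d_def a_minus_def r_distr r_minus r_neg flip: m_assoc)
    have md: "m \<otimes> d = m" if m: "m \<in> M'" for m
    proof -
      have mC: "m \<in> carrier R" and me: "m \<otimes> e = \<zero>" using m left_submoduleD(1)[OF M'] by (auto simp: M'_def)
      have "m \<otimes> d = m \<otimes> g \<ominus> (m \<otimes> e) \<otimes> g"
        using mC eC gC by (simp add: d_def a_minus_def r_distr r_minus m_assoc)
      then show ?thesis using g(2)[OF m] me gC mC by (simp add: a_minus_def)
    qed
    obtain h0 where h0: "h0 \<in> L" "h0 \<in> S (Suc k)" "\<rho> h0 = d" using dM2 by (auto simp: M_def)
    have h0C: "h0 \<in> carrier R" using h0 Lm(1) by auto
    \<comment> \<open>Multiplying the lift by d keeps its image equal to d, as d is idempotent, and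
      makes it absorb d and be annihilated by e.\<close>
    define h where "h = d \<otimes> h0"
    have hL: "h \<in> L" "h \<in> S (Suc k)" using h0 dC dB Lm(6) Sm(6) by (auto simp: h_def)
    have rh: "\<rho> h = d" using rho_mult[OF dB h0C] h0(3) md[OF dM] by (simp add: h_def)
    have dh: "d \<otimes> h = h" using md[OF dM] dC h0C by (simp add: h_def flip: m_assoc)
    have fC: "f \<in> carrier R" and hC: "h \<in> carrier R" using f hL Lm(1) by auto
    have "e \<otimes> h = (e \<otimes> d) \<otimes> h0" using eC dC h0C by (simp add: h_def m_assoc)
    then have eh: "e \<otimes> h = \<zero>" using ed h0C by simp
    have "d \<otimes> f = (d \<otimes> e) \<otimes> f" using eC dC fC e by (simp add: m_assoc)
    then have df: "d \<otimes> f = \<zero>" using de fC by simp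
    define f' where "f' = f \<oplus> h"
    define e' where "e' = e \<oplus> d"
    have f': "f' \<in> L" "f' \<in> S (Suc k)" "f' \<in> carrier R"
      using f hL Lm Sm(3)[of f "Suc k" h] S_mono[of k] fC hC by (auto simp: f'_def)
    have e': "e' \<in> B" "e' \<in> carrier R" using e(1) dB Ba eC dC by (auto simp: e'_def)
    have ef': "e \<otimes> f' = f" using eC fC hC e eh by (simp add: f'_def r_distr)
    have main: "\<rho> x \<otimes> e' = \<rho> x \<and> (\<exists>a\<in>carrier R. x = a \<otimes> f')" if x: "x \<in> L \<inter> S (Suc k)" for x
    proof
      define m where "m = \<rho> x"
      have xC: "x \<in> carrier R" using x Lm(1) by auto
      have mM: "m \<in> M" using x by (auto simp: m_def M_def)
      then have mB: "m \<in> B" and mC: "m \<in> carrier R" using MB Bc by auto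
      have me: "m \<otimes> e \<in> M" using eM mB Mm(6) by blast
      have "(m \<ominus> m \<otimes> e) \<otimes> e = \<zero>"
        using mC eC e(3) by (simp add: a_minus_def l_distr l_minus r_neg m_assoc)
      then have "m \<ominus> m \<otimes> e \<in> M'" using mM me Mm(5) by (simp add: M'_def)
      then have "(m \<ominus> m \<otimes> e) \<otimes> d = m \<ominus> m \<otimes> e" by (rule md)
      moreover have "(m \<ominus> m \<otimes> e) \<otimes> d = m \<otimes> d"
        using mC eC dC ed by (simp add: a_minus_def l_distr l_minus m_assoc)
      ultimately have "m \<otimes> d = m \<ominus> m \<otimes> e" by simp
      then have me': "m \<otimes> e' = m"
        using mC eC dC by (simp add: e'_def r_distr a_minus_def a_ac r_neg2 r_neg)
      then show "\<rho> x \<otimes> e' = \<rho> x" by (simp add: m_def)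
      \<comment> \<open>Since \<rho> maps m f' to m e' = m, the difference y has image zero. Hence t
        moves it one step down, where the induction hypothesis applies.\<close>
      define y where "y = x \<ominus> m \<otimes> f'"
      have "\<rho> (m \<otimes> f') = m"
        using rho_mult[OF mB f'(3)] rho_add[OF fC hC] e rh me' by (simp add: f'_def e'_def)
      then have ry: "\<rho> y = \<zero>"
        using rho_add[of x "\<ominus> (m \<otimes> f')"] rho_neg[of "m \<otimes> f'"] xC mC f'
        by (simp add: y_def a_minus_def r_neg flip: m_def)
      have y: "y \<in> L" "y \<in> S (Suc k)"
        using x f' mC mB Lm(5,6) Sm(5,6) by (auto simp: y_def)
      have "t \<otimes> y \<in> S k" by (rule S_shift[OF y(2) ry])
      then obtain a where a: "a \<in> carrier R" "t \<otimes> y = a \<otimes> f"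
        using IH[OF Lm(6)[OF tt(1) y(1)]] by blast
      have yC: "y \<in> carrier R" using y Lm by auto
      \<comment> \<open>Undoing the shift gives a multiple of the old generator f, and f = e f'
        turns it into a multiple of the new one.\<close>
      have "y = t' \<otimes> (t \<otimes> y)" using tt yC by (simp flip: m_assoc)
      also have "\<dots> = (t' \<otimes> a \<otimes> e) \<otimes> f'" using a tt eC f' by (simp add: m_assoc ef')
      finally have yf: "y = (t' \<otimes> a \<otimes> e) \<otimes> f'" .
      have "x = y \<oplus> m \<otimes> f'" using xC mC f' by (simp add: y_def a_minus_def a_assoc l_neg)
      also have "\<dots> = (t' \<otimes> a \<otimes> e) \<otimes> f' \<oplus> m \<otimes> f'" by (simp only: yf)
      also have "\<dots> = (t' \<otimes> a \<otimes> e \<oplus> m) \<otimes> f'" using tt a eC f' mC by (simp add: l_distr)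
      finally show "\<exists>a\<in>carrier R. x = a \<otimes> f'" using tt(2) a(1) eC mC
        by (intro bexI[of _ "t' \<otimes> a \<otimes> e \<oplus> m"]) auto
    qed
    have r: "\<rho> f' = e'" using rho_add[OF fC hC] e rh by (simp add: f'_def e'_def)
    then have "e' \<otimes> e' = e'" using main[of f'] f' by simp
    moreover have "e' \<otimes> f' = f'"
      using eC dC fC hC e eh df dh by (simp add: e'_def f'_def l_distr r_distr)
    ultimately show ?case using f' e' r main by blast
  qed
  then show ?thesis by blast
qed

end

subsection \<open>Elements of the twisted skew group ring by support\<close>

context crossed_system
begin

interpretation A: ring skew_ring by (rule ring_skew_ring)

abbreviation (input) skew_times (infixl "\<star>" 70) where "f \<star> h \<equiv> f \<otimes>\<^bsub>skew_ring\<^esub> h"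
abbreviation (input) skew_plus (infixl "\<boxplus>" 65) where "f \<boxplus> h \<equiv> f \<oplus>\<^bsub>skew_ring\<^esub> h"

section \<open>Monomials, their products and inverses\<close>

definition monomial where
  "monomial c x = (\<lambda>g\<in>carrier G. if g = x then c else \<zero>\<^bsub>K\<^esub>)"

definition supported where
  "supported T = {f \<in> carrier skew_ring. supp f \<subseteq> T}"

lemma monomial_coeff: "g \<in> carrier G \<Longrightarrow> monomial c x g = (if g = x then c else \<zero>\<^bsub>K\<^esub>)"
  by (simp add: monomial_def)

lemma monomial_closed [simp]: "x \<in> carrier G \<Longrightarrow> c \<in> carrier K \<Longrightarrow> monomial c x \<in> carrier skew_ring"
  using skew_mult_basis(1)[of x x c c] by (simp add: monomial_def)

lemma monomial_mult:
  "\<lbrakk>x \<in> carrier G; y \<in> carrier G; a \<in> carrier K; b \<in> carrier K\<rbrakk> \<Longrightarrow>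
    monomial a x \<star> monomial b y = monomial (a \<otimes>\<^bsub>K\<^esub> \<sigma> x b \<otimes>\<^bsub>K\<^esub> \<alpha> x y) (x \<otimes>\<^bsub>G\<^esub> y)"
  using skew_mult_basis(2)[of x y a b] by (simp add: monomial_def)

lemma monomial_one: "monomial \<one>\<^bsub>K\<^esub> \<one>\<^bsub>G\<^esub> = \<one>\<^bsub>skew_ring\<^esub>"
  by (rule skew_eqI) (auto simp: monomial_coeff skew_one_coeff)

lemma monomial_add:
  "\<lbrakk>x \<in> carrier G; a \<in> carrier K; b \<in> carrier K\<rbrakk> \<Longrightarrow>
    monomial (a \<oplus>\<^bsub>K\<^esub> b) x = monomial a x \<boxplus> monomial b x"
  by (rule skew_eqI) (auto simp: monomial_coeff skew_add_coeff)

lemma monomial_supported: "x \<in> carrier G \<Longrightarrow> c \<in> carrier K \<Longrightarrow> x \<in> T \<Longrightarrow> monomial c x \<in> supported T"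
  by (auto simp: supported_def coeff_support_def monomial_coeff split: if_splits)

lemma monomial_scalar_left:
  "\<lbrakk>x \<in> carrier G; c \<in> carrier K; d \<in> carrier K\<rbrakk> \<Longrightarrow>
    monomial c \<one>\<^bsub>G\<^esub> \<star> monomial d x = monomial (c \<otimes>\<^bsub>K\<^esub> d) x"
  by (simp add: monomial_mult sigma_one alpha_l_one)

lemma monomial_scalar_right:
  "\<lbrakk>x \<in> carrier G; c \<in> carrier K; d \<in> carrier K\<rbrakk> \<Longrightarrow>
    monomial d x \<star> monomial c \<one>\<^bsub>G\<^esub> = monomial (d \<otimes>\<^bsub>K\<^esub> \<sigma> x c) x"
  by (simp add: monomial_mult alpha_r_one sigma_closed)

text \<open>The product formula suggests a left inverse with coefficient \<open>d\<close> and a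
  right inverse with coefficient \<open>e\<close>. Associativity in the ring identifies the two, in
  place of a computation with the cocycle identity.\<close>

lemma monomial_inverse:
  assumes x: "x \<in> carrier G"
  obtains d where "d \<in> carrier K" "monomial d (inv\<^bsub>G\<^esub> x) \<star> monomial \<one>\<^bsub>K\<^esub> x = \<one>\<^bsub>skew_ring\<^esub>"
    "monomial \<one>\<^bsub>K\<^esub> x \<star> monomial d (inv\<^bsub>G\<^esub> x) = \<one>\<^bsub>skew_ring\<^esub>"
proof -
  let ?a = "\<alpha> (inv\<^bsub>G\<^esub> x) x" and ?b = "\<alpha> x (inv\<^bsub>G\<^esub> x)" and ?x = "inv\<^bsub>G\<^esub> x"
  have u: "?a \<in> Units K" "?b \<in> Units K" using x by (simp_all add: K.field_Units alpha_simps)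
  define d where "d = inv\<^bsub>K\<^esub> ?a"
  define e where "e = \<sigma> ?x (inv\<^bsub>K\<^esub> ?b)"
  have d: "d \<in> carrier K" and e: "e \<in> carrier K" using u x by (simp_all add: d_def e_def sigma_closed)
  have l: "monomial d ?x \<star> monomial \<one>\<^bsub>K\<^esub> x = \<one>\<^bsub>skew_ring\<^esub>"
    using x d u by (simp add: monomial_mult sigma_simps d_def monomial_one)
  have "\<sigma> x e = inv\<^bsub>K\<^esub> ?b" using x u by (simp add: e_def sigma_comp sigma_one)
  then have r: "monomial \<one>\<^bsub>K\<^esub> x \<star> monomial e ?x = \<one>\<^bsub>skew_ring\<^esub>"
    using x e u by (simp add: monomial_mult monomial_one)
  have "monomial d ?x = monomial d ?x \<star> (monomial \<one>\<^bsub>K\<^esub> x \<star> monomial e ?x)"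
    unfolding r using x d by simp
  also have "\<dots> = monomial e ?x"
    using l x d e by (simp flip: A.m_assoc)
  finally show ?thesis using that[OF d l] r by simp
qed

lemma skew_neg_coeff:
  assumes "f \<in> carrier skew_ring" "g \<in> carrier G"
  shows "(\<ominus>\<^bsub>skew_ring\<^esub> f) g = \<ominus>\<^bsub>K\<^esub> f g"
proof -
  have "f g \<oplus>\<^bsub>K\<^esub> (\<ominus>\<^bsub>skew_ring\<^esub> f) g = \<zero>\<^bsub>K\<^esub>"
    using assms A.r_neg[of f] by (metis skew_add_coeff skew_zero_coeff)
  then show ?thesis
    using assms by (metis K.minus_equality K.a_comm A.a_inv_closed skew_coeff)
qed

section \<open>Elements supported on a given subset of the group\<close>

lemma supportedD: "f \<in> supported T \<Longrightarrow> f \<in> carrier skew_ring" "f \<in> supported T \<Longrightarrow> supp f \<subseteq> T"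
  by (simp_all add: supported_def)

lemma supported_zero: "\<zero>\<^bsub>skew_ring\<^esub> \<in> supported T"
  by (auto simp: supported_def coeff_support_def skew_zero_coeff)

lemma supported_add: "f \<in> supported T \<Longrightarrow> h \<in> supported T \<Longrightarrow> f \<boxplus> h \<in> supported T"
  by (force simp: supported_def coeff_support_def skew_add_coeff)

lemma supported_neg: "f \<in> supported T \<Longrightarrow> \<ominus>\<^bsub>skew_ring\<^esub> f \<in> supported T"
  by (auto simp: supported_def coeff_support_def skew_neg_coeff)

lemma supp_mult: "supp (f \<star> h) \<subseteq> supp f <#>\<^bsub>G\<^esub> supp h"
proof
  fix g assume g: "g \<in> supp (f \<star> h)"
  then have gG: "g \<in> carrier G" by (simp add: coeff_support_def)
  show "g \<in> supp f <#>\<^bsub>G\<^esub> supp h"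
  proof (rule ccontr)
    assume "\<not> ?thesis"
    then have e: "{(x, y) \<in> supp f \<times> supp h. x \<otimes>\<^bsub>G\<^esub> y = g} = {}" by (auto simp: set_mult_def)
    have "(f \<star> h) g = \<zero>\<^bsub>K\<^esub>" unfolding skew_mult_coeff[OF gG] e by (rule K.finsum_empty)
    then show False using g unfolding coeff_support_def[of G K "f \<star> h"] by blast
  qed
qed

lemma supported_mult:
  assumes "f \<in> supported T" "h \<in> supported U"
  shows "f \<star> h \<in> supported (T <#>\<^bsub>G\<^esub> U)"
proof -
  have "supp f <#>\<^bsub>G\<^esub> supp h \<subseteq> T <#>\<^bsub>G\<^esub> U" using assms by (auto simp: supported_def set_mult_def)
  then show ?thesis using assms supp_mult[of f h] by (auto simp: supported_def)
qed

lemma supported_mono: "T \<subseteq> U \<Longrightarrow> supported T \<subseteq> supported U"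
  by (auto simp: supported_def)

lemma supported_subring:
  assumes N: "subgroup N G"
  shows "subring (supported N) skew_ring"
proof (rule A.subringI)
  show "\<one>\<^bsub>skew_ring\<^esub> \<in> supported N"
    using subgroup.one_closed[OF N] by (simp add: supported_def supp_one)
  have "N <#>\<^bsub>G\<^esub> N = N" using N by (simp add: G.subgroup_mult_id)
  then show "f \<star> h \<in> supported N" if "f \<in> supported N" "h \<in> supported N" for f h
    using supported_mult[OF that] by simp
qed (auto simp: supportedD supported_add supported_neg)

text \<open>Induction on the size of the support, splitting off one point at a time. It reduces
  identities that are additive in f to monomials.\<close>

lemma supported_induct [consumes 1, case_names zero monomial add]:
  assumes "f \<in> supported T"
    and zero: "P \<zero>\<^bsub>skew_ring\<^esub>"
    and mono: "\<And>c x. c \<in> carrier K \<Longrightarrow> x \<in> carrier G \<Longrightarrow> x \<in> T \<Longrightarrow> P (monomial c x)"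
    and add: "\<And>f h. f \<in> supported T \<Longrightarrow> h \<in> supported T \<Longrightarrow> P f \<Longrightarrow> P h \<Longrightarrow> P (f \<boxplus> h)"
  shows "P f"
proof -
  have "finite (supp f)" using assms(1) by (simp add: supported_def skew_finite_supp)
  then show ?thesis using assms(1)
  proof (induction "supp f" arbitrary: f rule: finite_induct)
    case empty
    then have "f = \<zero>\<^bsub>skew_ring\<^esub>"
      by (intro skew_eqI) (auto simp: supported_def coeff_support_def skew_zero_coeff)
    then show ?case using zero by simp
  next
    case (insert x F)
    have f: "f \<in> carrier skew_ring" and T: "supp f \<subseteq> T" using insert by (auto simp: supported_def)
    have xG: "x \<in> carrier G" using insert.hyps(4) supp_subset[of f] by auto
    then have x: "x \<in> carrier G" "x \<in> T" "f x \<in> carrier K"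
      using insert.hyps(4) T f by (auto simp: skew_coeff)
    define h where "h = (\<lambda>g\<in>carrier G. if g = x then \<zero>\<^bsub>K\<^esub> else f g)"
    have sh: "supp h = F"
      using insert.hyps(2,4) by (auto simp: h_def coeff_support_def split: if_splits)
    have h: "h \<in> carrier skew_ring"
      using f insert.hyps(1) unfolding skew_carrier sh by (auto simp: h_def skew_coeff)
    have hT: "h \<in> supported T" using h sh insert.hyps(4) T by (auto simp: supported_def)
    have "f = monomial (f x) x \<boxplus> h"
      using f h x by (intro skew_eqI) (auto simp: skew_add_coeff monomial_coeff h_def skew_coeff)
    moreover have "P (monomial (f x) x \<boxplus> h)"
      using x hT insert.hyps(3)[OF sh[symmetric] hT] by (intro add mono monomial_supported) auto
    ultimately show ?case by simp
  qed
qed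

lemma supported_all: "supported (carrier G) = carrier skew_ring"
  by (auto simp: supported_def coeff_support_def)

section \<open>Projection onto the part supported on a subgroup\<close>

definition restriction where
  "restriction N f = (\<lambda>g\<in>carrier G. if g \<in> N then f g else \<zero>\<^bsub>K\<^esub>)"

lemma restriction_coeff: "g \<in> carrier G \<Longrightarrow> restriction N f g = (if g \<in> N then f g else \<zero>\<^bsub>K\<^esub>)"
  by (simp add: restriction_def)

lemma restriction_supported:
  assumes "f \<in> carrier skew_ring"
  shows "restriction N f \<in> supported N"
proof -
  have "supp (restriction N f) \<subseteq> supp f" by (auto simp: coeff_support_def restriction_coeff split: if_splits)
  then have "finite (supp (restriction N f))" using assms finite_subset skew_finite_supp by blast
  then have "restriction N f \<in> carrier skew_ring"
    using assms by (auto simp: skew_carrier restriction_def)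
  then show ?thesis by (auto simp: supported_def coeff_support_def restriction_coeff split: if_splits)
qed

lemmas restriction_closed = supportedD(1)[OF restriction_supported]

lemma restriction_add:
  "f \<in> carrier skew_ring \<Longrightarrow> h \<in> carrier skew_ring \<Longrightarrow>
    restriction N (f \<boxplus> h) = restriction N f \<boxplus> restriction N h"
  by (rule skew_eqI) (auto simp: restriction_closed restriction_coeff skew_add_coeff)

text \<open>Left translation by an element of N preserves both N and its complement, so left
  multiplication by \<open>supported N\<close> respects the splitting of the ring along N.\<close>

lemma restriction_mult:
  assumes N: "subgroup N G" and b: "b \<in> supported N" and f: "f \<in> carrier skew_ring"
  shows "restriction N (b \<star> f) = b \<star> restriction N f"
proof (rule skew_eqI)
  have bA: "b \<in> carrier skew_ring" using b supportedD by blast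
  show "restriction N (b \<star> f) \<in> carrier skew_ring" "b \<star> restriction N f \<in> carrier skew_ring"
    using bA f by (auto simp: restriction_closed)
  fix g assume g: "g \<in> carrier G"
  have sb: "supp b \<subseteq> N" using b supportedD by blast
  have coeff: "(b \<star> h) g = finsum K (\<lambda>x. coeff_term b h x (inv\<^bsub>G\<^esub> x \<otimes>\<^bsub>G\<^esub> g)) (supp b)"
    if "h \<in> carrier skew_ring" for h
    using bA that g by (intro skew_mult_coeff_left) (auto simp: skew_finite_supp supp_subset)
  have mem: "inv\<^bsub>G\<^esub> x \<otimes>\<^bsub>G\<^esub> g \<in> N \<longleftrightarrow> g \<in> N" if "x \<in> supp b" for x
  proof -
    have x: "x \<in> N" "x \<in> carrier G" using that sb supp_subset by auto
    show ?thesis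
    proof
      assume "inv\<^bsub>G\<^esub> x \<otimes>\<^bsub>G\<^esub> g \<in> N"
      then have "x \<otimes>\<^bsub>G\<^esub> (inv\<^bsub>G\<^esub> x \<otimes>\<^bsub>G\<^esub> g) \<in> N" using x subgroup.m_closed[OF N] by blast
      then show "g \<in> N" using x g by (simp flip: G.m_assoc)
    qed (use x N in \<open>auto intro: subgroup.m_closed subgroup.m_inv_closed\<close>)
  qed
  show "restriction N (b \<star> f) g = (b \<star> restriction N f) g"
  proof (cases "g \<in> N")
    case True
    have "finsum K (\<lambda>x. coeff_term b f x (inv\<^bsub>G\<^esub> x \<otimes>\<^bsub>G\<^esub> g)) (supp b)
      = finsum K (\<lambda>x. coeff_term b (restriction N f) x (inv\<^bsub>G\<^esub> x \<otimes>\<^bsub>G\<^esub> g)) (supp b)"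
      using True mem bA f g supp_subset[of b]
      by (intro K.finsum_cong')
        (auto simp: coeff_term_closed restriction_closed subset_iff,
          auto simp: coeff_term_def restriction_coeff subset_iff)
    then show ?thesis using True g f by (simp add: restriction_coeff coeff restriction_closed)
  next
    case False
    have "finsum K (\<lambda>x. coeff_term b (restriction N f) x (inv\<^bsub>G\<^esub> x \<otimes>\<^bsub>G\<^esub> g)) (supp b)
      = finsum K (\<lambda>x. \<zero>\<^bsub>K\<^esub>) (supp b)"
      using False mem bA f g supp_subset[of b]
      by (intro K.finsum_cong' refl coeff_term_zero)
        (auto simp: restriction_coeff restriction_closed subset_iff)
    then show ?thesis using False g f by (simp add: restriction_coeff coeff restriction_closed)
  qed
qed

subsection \<open>Maschke's theorem and principal left ideals\<close>

abbreviation (input) scalar where "scalar c \<equiv> monomial c \<one>\<^bsub>G\<^esub>"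

lemma skew_finite:
  assumes "finite (carrier G)" "finite (carrier K)"
  shows "finite (carrier skew_ring)" "card (carrier skew_ring) = card (carrier K) ^ card (carrier G)"
proof -
  have "carrier skew_ring = carrier G \<rightarrow>\<^sub>E carrier K"
    using assms by (auto simp: skew_carrier coeff_support_def)
  then show "finite (carrier skew_ring)" "card (carrier skew_ring) = card (carrier K) ^ card (carrier G)"
    using assms by (simp_all add: finite_PiE card_PiE)
qed

text \<open>Each summand of the average conjugates a K-linear projection onto M by the unit
  \<open>u g\<close>; the semilinear twists of \<open>u g\<close> and its inverse \<open>v g\<close>
  cancel, and the average is linear over the whole subring. Linearity then gives x q(1) = q(x) = |N|
  x on M, so a suitable multiple of q(1) is the required right identity.\<close>

lemma maschke:
  assumes fin: "finite (carrier G)" "finite (carrier K)" and N: "subgroup N G"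
    and cop: "coprime (card N) (card (carrier K))"
    and MN: "M \<subseteq> supported N" and M: "left_submodule (supported N) M skew_ring"
  shows "\<exists>e\<in>M. \<forall>x\<in>M. x \<star> e = x"
proof -
  note Mm = A.left_submoduleD[OF M]
  have finN: "finite N" using subgroup.subset[OF N] fin(1) finite_subset by blast
  have NG: "g \<in> carrier G" if "g \<in> N" for g using that subgroup.mem_carrier[OF N] by blast
  define u where "u g = monomial \<one>\<^bsub>K\<^esub> g" for g
  have "\<forall>g\<in>N. \<exists>v\<in>supported N. v \<star> u g = \<one>\<^bsub>skew_ring\<^esub> \<and> u g \<star> v = \<one>\<^bsub>skew_ring\<^esub>"
  proof
    fix g assume g: "g \<in> N"
    obtain d where "d \<in> carrier K" "monomial d (inv\<^bsub>G\<^esub> g) \<star> u g = \<one>\<^bsub>skew_ring\<^esub>"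
        "u g \<star> monomial d (inv\<^bsub>G\<^esub> g) = \<one>\<^bsub>skew_ring\<^esub>"
      using monomial_inverse[OF NG[OF g]] unfolding u_def by blast
    then show "\<exists>v\<in>supported N. v \<star> u g = \<one>\<^bsub>skew_ring\<^esub> \<and> u g \<star> v = \<one>\<^bsub>skew_ring\<^esub>"
      using g NG subgroup.m_inv_closed[OF N g] by (intro bexI[of _ "monomial d (inv\<^bsub>G\<^esub> g)"])
        (auto intro!: monomial_supported)
  qed
  then obtain v where v: "\<And>g. g \<in> N \<Longrightarrow> v g \<in> supported N"
    "\<And>g. g \<in> N \<Longrightarrow> v g \<star> u g = \<one>\<^bsub>skew_ring\<^esub>" "\<And>g. g \<in> N \<Longrightarrow> u g \<star> v g = \<one>\<^bsub>skew_ring\<^esub>"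
    by metis
  have uN: "u g \<in> supported N" if "g \<in> N" for g
    using that NG by (auto simp: u_def intro: monomial_supported)
  note [simp] = supportedD(1)[OF v(1)] supportedD(1)[OF uN]
  have scN: "scalar c \<in> supported N" if "c \<in> carrier K" for c
    using that subgroup.one_closed[OF N] by (auto intro: monomial_supported)
  have sc [simp]: "scalar c \<in> carrier skew_ring" if "c \<in> carrier K" for c
    using that by simp
  obtain \<pi> where pM: "\<pi> \<in> carrier skew_ring \<rightarrow> M" and pid: "\<And>x. x \<in> M \<Longrightarrow> \<pi> x = x"
    and padd: "\<And>x y. \<lbrakk>x \<in> carrier skew_ring; y \<in> carrier skew_ring\<rbrakk> \<Longrightarrow> \<pi> (x \<boxplus> y) = \<pi> x \<boxplus> \<pi> y"
    and psc: "\<And>c x. \<lbrakk>c \<in> carrier K; x \<in> carrier skew_ring\<rbrakk> \<Longrightarrow> \<pi> (scalar c \<star> x) = scalar c \<star> \<pi> x"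
  proof (rule A.action_projection[of K "\<lambda>c x. scalar c \<star> x" M])
    show "field K" by (rule K.field_axioms)
    show "additive_subgroup M skew_ring" using M by (simp add: left_submodule_def)
  qed (use fin skew_finite Mm(6) scN in \<open>auto simp: A.l_distr A.r_distr A.m_assoc monomial_add monomial_one
        simp flip: monomial_scalar_left\<close>)
  have pC [simp]: "\<pi> x \<in> carrier skew_ring" if "x \<in> carrier skew_ring" for x
    using pM Mm(1) that by blast
  \<comment> \<open>\<open>q\<close> is \<open>card N\<close> times the \<open>B\<close>-linear projection onto \<open>M\<close>; its value at \<open>1\<close> is divided by \<open>card N\<close> below.\<close>
  define q where "q x = finsum skew_ring (\<lambda>g. v g \<star> \<pi> (u g \<star> x)) N" for x
  have qC [simp]: "q x \<in> carrier skew_ring" if "x \<in> carrier skew_ring" for x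
    using that by (auto simp: q_def intro!: A.finsum_closed)
  have qadd: "q (x \<boxplus> y) = q x \<boxplus> q y" if "x \<in> carrier skew_ring" "y \<in> carrier skew_ring" for x y
  proof -
    have "q (x \<boxplus> y) = finsum skew_ring (\<lambda>g. v g \<star> \<pi> (u g \<star> x) \<boxplus> v g \<star> \<pi> (u g \<star> y)) N"
      unfolding q_def using that by (intro A.finsum_cong') (auto simp: A.r_distr padd)
    then show ?thesis unfolding q_def using that by (simp add: A.finsum_addf Pi_def)
  qed
  have qsc: "q (scalar c \<star> x) = scalar c \<star> q x" if c: "c \<in> carrier K" and x: "x \<in> carrier skew_ring" for c x
  proof -
    \<comment> \<open>The scalar c becomes \<open>\<sigma> g c\<close> when it passes
      \<open>u g\<close>, goes through \<pi>, and turns back into c when it passes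
      \<open>v g\<close>.\<close>
    have "v g \<star> \<pi> (u g \<star> (scalar c \<star> x)) = scalar c \<star> (v g \<star> \<pi> (u g \<star> x))" if g: "g \<in> N" for g
    proof -
      have s: "\<sigma> g c \<in> carrier K" using g c NG by (simp add: sigma_closed)
      have comm: "u g \<star> scalar c = scalar (\<sigma> g c) \<star> u g"
        using g c NG s by (simp add: u_def monomial_scalar_left monomial_scalar_right)
      have comm': "v g \<star> scalar (\<sigma> g c) = scalar c \<star> v g"
      proof -
        have "v g \<star> scalar (\<sigma> g c) = v g \<star> (scalar (\<sigma> g c) \<star> u g) \<star> v g"
          using g c s v(3) by (simp add: A.m_assoc)
        also have "\<dots> = (v g \<star> u g) \<star> scalar c \<star> v g"
          using g c s by (simp add: A.m_assoc flip: comm)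
        also have "\<dots> = scalar c \<star> v g" using g c v(2) by simp
        finally show ?thesis .
      qed
      have "v g \<star> \<pi> (u g \<star> (scalar c \<star> x)) = v g \<star> \<pi> (scalar (\<sigma> g c) \<star> (u g \<star> x))"
        using g c x s comm by (simp flip: A.m_assoc)
      also have "\<dots> = (v g \<star> scalar (\<sigma> g c)) \<star> \<pi> (u g \<star> x)"
        using g c x s by (simp add: psc A.m_assoc)
      finally show ?thesis using comm' g c x by (simp add: A.m_assoc)
    qed
    then show ?thesis unfolding q_def using c x
      by (subst A.finsum_rdistr) (auto intro!: A.finsum_cong' finN simp: finN)
  qed
  have qu: "q (u h \<star> x) = u h \<star> q x" if h: "h \<in> N" and x: "x \<in> carrier skew_ring" for h x
  proof -
    define F where "F g = v g \<star> \<pi> (u g \<star> x)" for g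
    have FC: "F g \<in> carrier skew_ring" if "g \<in> N" for g using that x by (simp add: F_def)
    \<comment> \<open>The cocycle value in \<open>u g \<star> u h\<close> passes through \<pi> as a
      scalar and is absorbed by \<open>v g\<close>. The summand at g thus becomes \<open>u h\<close>
      times the summand at gh, and right translation by h merely permutes N.\<close>
    have step: "v g \<star> \<pi> (u g \<star> (u h \<star> x)) = u h \<star> F (g \<otimes>\<^bsub>G\<^esub> h)" if g: "g \<in> N" for g
    proof -
      have gh: "g \<otimes>\<^bsub>G\<^esub> h \<in> N" using g h subgroup.m_closed[OF N] by blast
      have a: "\<alpha> g h \<in> carrier K" using g h NG by (simp add: alpha_simps)
      have uu: "u g \<star> u h = scalar (\<alpha> g h) \<star> u (g \<otimes>\<^bsub>G\<^esub> h)"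
        using g h NG a by (simp add: u_def monomial_mult sigma_simps sigma_one alpha_l_one)
      have vv: "v g \<star> scalar (\<alpha> g h) = u h \<star> v (g \<otimes>\<^bsub>G\<^esub> h)"
      proof -
        have "v g \<star> scalar (\<alpha> g h) = v g \<star> (scalar (\<alpha> g h) \<star> u (g \<otimes>\<^bsub>G\<^esub> h)) \<star> v (g \<otimes>\<^bsub>G\<^esub> h)"
          using g gh a v(3) by (simp add: A.m_assoc)
        also have "\<dots> = (v g \<star> u g) \<star> u h \<star> v (g \<otimes>\<^bsub>G\<^esub> h)"
          using g h gh by (simp add: A.m_assoc flip: uu)
        also have "\<dots> = u h \<star> v (g \<otimes>\<^bsub>G\<^esub> h)" using g h v(2) by simp
        finally show ?thesis .
      qed
      have "v g \<star> \<pi> (u g \<star> (u h \<star> x)) = v g \<star> \<pi> (scalar (\<alpha> g h) \<star> (u (g \<otimes>\<^bsub>G\<^esub> h) \<star> x))"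
        using g h gh x a uu by (simp flip: A.m_assoc)
      also have "\<dots> = (v g \<star> scalar (\<alpha> g h)) \<star> \<pi> (u (g \<otimes>\<^bsub>G\<^esub> h) \<star> x)"
        using g gh x a by (simp add: psc A.m_assoc)
      finally show ?thesis using vv g h gh x by (simp add: A.m_assoc F_def)
    qed
    have img: "(\<lambda>g. g \<otimes>\<^bsub>G\<^esub> h) ` N = N"
    proof (intro equalityI subsetI)
      fix g assume g: "g \<in> N"
      then have "g = (g \<otimes>\<^bsub>G\<^esub> inv\<^bsub>G\<^esub> h) \<otimes>\<^bsub>G\<^esub> h" using h NG by (simp add: G.m_assoc)
      then show "g \<in> (\<lambda>g. g \<otimes>\<^bsub>G\<^esub> h) ` N"
        using g h subgroup.m_closed[OF N] subgroup.m_inv_closed[OF N] by blast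
    qed (use h subgroup.m_closed[OF N] in blast)
    have "q (u h \<star> x) = finsum skew_ring (\<lambda>g. u h \<star> F (g \<otimes>\<^bsub>G\<^esub> h)) N"
      unfolding q_def using step h FC subgroup.m_closed[OF N] by (intro A.finsum_cong') auto
    also have "\<dots> = finsum skew_ring (\<lambda>g. u h \<star> F g) N"
      using h FC NG A.finsum_reindex[of "\<lambda>g. u h \<star> F g" "\<lambda>g. g \<otimes>\<^bsub>G\<^esub> h" N]
      by (auto simp: img inj_on_def)
    also have "\<dots> = u h \<star> q x"
      unfolding q_def F_def[symmetric] using h FC finN by (subst A.finsum_rdistr) auto
    finally show ?thesis .
  qed
  have qlin: "q (b \<star> x) = b \<star> q x" if "b \<in> supported N" and x: "x \<in> carrier skew_ring" for b x
    using that(1)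
  proof (induction rule: supported_induct)
    case zero
    have "q \<zero>\<^bsub>skew_ring\<^esub> \<boxplus> q \<zero>\<^bsub>skew_ring\<^esub> = q \<zero>\<^bsub>skew_ring\<^esub>"
      using qadd[of "\<zero>\<^bsub>skew_ring\<^esub>" "\<zero>\<^bsub>skew_ring\<^esub>"] by simp
    then have "q \<zero>\<^bsub>skew_ring\<^esub> = \<zero>\<^bsub>skew_ring\<^esub>" by (simp add: A.add.r_cancel_one')
    then show ?case using x by simp
  next
    case (monomial c g)
    have "monomial c g = scalar c \<star> u g" using monomial by (simp add: u_def monomial_scalar_left)
    then show ?case using monomial x by (simp add: A.m_assoc qsc qu)
  next
    case (add f h)
    then show ?case using x by (simp add: supportedD A.l_distr qadd)
  qed
  have qM: "q x = add_pow skew_ring (card N) x" if x: "x \<in> M" for x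
  proof -
    have xC: "x \<in> carrier skew_ring" using x Mm by blast
    have "v g \<star> \<pi> (u g \<star> x) = x" if "g \<in> N" for g
      using that pid[of "u g \<star> x"] Mm(6)[OF uN[OF that] x] xC v(2) by (simp flip: A.m_assoc)
    then have "q x = finsum skew_ring (\<lambda>g. x) N" unfolding q_def using xC by (intro A.finsum_cong') auto
    then show ?thesis using A.add.finprod_const[OF xC, of N] by simp
  qed
  have q1M: "q \<one>\<^bsub>skew_ring\<^esub> \<in> M"
  proof -
    have "finsum skew_ring (\<lambda>g. v g \<star> \<pi> (u g \<star> \<one>\<^bsub>skew_ring\<^esub>)) S \<in> M" if "finite S" "S \<subseteq> N" for S
      using that
    proof (induction S rule: finite_induct)
      case (insert g S)
      have "v g \<star> \<pi> (u g \<star> \<one>\<^bsub>skew_ring\<^esub>) \<in> M"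
        using insert.prems funcset_mem[OF pM] Mm(6)[OF v(1)] by auto
      then show ?case using insert by (subst A.finsum_insert) (auto simp: Mm)
    qed (simp add: Mm)
    then show ?thesis unfolding q_def using finN by blast
  qed
  \<comment> \<open>The additive group of A is annihilated by |A|, which is a power of |K| and hence
    coprime to |N|. Bezout supplies an integer m that inverts |N| modulo |A|.\<close>
  let ?Q = "card (carrier skew_ring)"
  have "coprime (card N) ?Q" using cop skew_finite[OF fin] by simp
  moreover have "card N \<noteq> 0" using finN subgroup.one_closed[OF N] by auto
  ultimately obtain m y where m: "card N * m = ?Q * y + 1" using bezout_nat[of "card N" ?Q] by auto
  have tors: "add_pow skew_ring (card N * m) x = x" if x: "x \<in> carrier skew_ring" for x
  proof -
    have "add_pow skew_ring ?Q x = \<zero>\<^bsub>skew_ring\<^esub>"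
      using group.pow_order_eq_1[OF A.a_group, of x] x by (simp add: order_def add_pow_def)
    then have "add_pow skew_ring (?Q * y) x = \<zero>\<^bsub>skew_ring\<^esub>"
      using A.add.nat_pow_pow[OF x, of y ?Q] by simp
    then show ?thesis using x by (simp add: m)
  qed
  define e where "e = add_pow skew_ring m (q \<one>\<^bsub>skew_ring\<^esub>)"
  have "e \<in> M" unfolding e_def
  proof (induction m)
    case (Suc m)
    then show ?case using q1M by (simp add: A.add.nat_pow_Suc Mm)
  qed (simp add: Mm)
  moreover have "x \<star> e = x" if x: "x \<in> M" for x
  proof -
    have xC: "x \<in> carrier skew_ring" and xN: "x \<in> supported N" using x Mm MN by auto
    have "x \<star> e = add_pow skew_ring m (x \<star> q \<one>\<^bsub>skew_ring\<^esub>)"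
      unfolding e_def using xC by (simp add: A.add_pow_rdistr)
    also have "x \<star> q \<one>\<^bsub>skew_ring\<^esub> = add_pow skew_ring (card N) x"
      using qlin[OF xN A.one_closed] qM[OF x] xC by simp
    also have "add_pow skew_ring m (add_pow skew_ring (card N) x) = add_pow skew_ring (card N * m) x"
      using xC by (simp add: A.add.nat_pow_pow)
    also have "\<dots> = x" by (rule tors[OF xC])
    finally show ?thesis .
  qed
  ultimately show ?thesis by blast
qed

lemma left_ideal_principal:
  assumes fin: "finite (carrier G)" "finite (carrier K)" and N: "subgroup N G"
    and cop: "coprime (card N) (card (carrier K))"
    and conj: "\<And>g n. g \<in> carrier G \<Longrightarrow> n \<in> N \<Longrightarrow> g \<otimes>\<^bsub>G\<^esub> n \<otimes>\<^bsub>G\<^esub> inv\<^bsub>G\<^esub> g \<in> N"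
    and s: "s \<in> carrier G" and gen: "\<And>g. g \<in> carrier G \<Longrightarrow> \<exists>n\<in>N. \<exists>i::nat. g = n \<otimes>\<^bsub>G\<^esub> s [^]\<^bsub>G\<^esub> i"
    and L: "left_submodule (carrier skew_ring) L skew_ring"
  shows "\<exists>f\<in>L. \<forall>x\<in>L. \<exists>a\<in>carrier skew_ring. x = a \<star> f"
proof -
  have NG: "n \<in> carrier G" if "n \<in> N" for n using that subgroup.mem_carrier[OF N] by blast
  \<comment> \<open>The form n s^i need not be unique. The sets \<open>T k\<close> only have to
    increase, be stable under left multiplication by N, exhaust G, and admit the shift by the
    inverse of s.\<close>
  define T where "T k = {n \<otimes>\<^bsub>G\<^esub> s [^]\<^bsub>G\<^esub> i | n i. n \<in> N \<and> i < k}" for k :: nat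
  have "\<forall>g\<in>carrier G. \<exists>i::nat. \<exists>n\<in>N. g = n \<otimes>\<^bsub>G\<^esub> s [^]\<^bsub>G\<^esub> i" using gen by blast
  then obtain ix :: "'a \<Rightarrow> nat" where ix: "\<And>g. g \<in> carrier G \<Longrightarrow> \<exists>n\<in>N. g = n \<otimes>\<^bsub>G\<^esub> s [^]\<^bsub>G\<^esub> ix g"
    by metis
  \<comment> \<open>One exponent is chosen for each of the finitely many group elements; the
    successor of the largest is where the filtration reaches all of G.\<close>
  define k where "k = Suc (Max (ix ` carrier G))"
  have full: "carrier G \<subseteq> T k"
  proof
    fix g assume g: "g \<in> carrier G"
    then have "ix g < k" using fin by (simp add: k_def le_imp_less_Suc)
    then show "g \<in> T k" using ix[OF g] by (auto simp: T_def)
  qed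
  have NT: "N <#>\<^bsub>G\<^esub> T j \<subseteq> T j" for j
  proof
    fix g assume "g \<in> N <#>\<^bsub>G\<^esub> T j"
    then obtain n m i where g: "n \<in> N" "m \<in> N" "i < j" "g = n \<otimes>\<^bsub>G\<^esub> (m \<otimes>\<^bsub>G\<^esub> s [^]\<^bsub>G\<^esub> i)"
      by (auto simp: set_mult_def T_def)
    then have "g = (n \<otimes>\<^bsub>G\<^esub> m) \<otimes>\<^bsub>G\<^esub> s [^]\<^bsub>G\<^esub> i" using NG s by (simp add: G.m_assoc)
    moreover have "n \<otimes>\<^bsub>G\<^esub> m \<in> N" using g subgroup.m_closed[OF N] by blast
    ultimately show "g \<in> T j" using g(3) by (auto simp: T_def)
  qed
  obtain d where d: "d \<in> carrier K"
    and ds: "monomial \<one>\<^bsub>K\<^esub> s \<star> monomial d (inv\<^bsub>G\<^esub> s) = \<one>\<^bsub>skew_ring\<^esub>"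
    using monomial_inverse[OF s] by blast
  have "\<exists>f\<in>L. \<forall>x\<in>L \<inter> supported (T k). \<exists>a\<in>carrier skew_ring. x = a \<star> f"
  proof (rule A.left_ideal_principal_of_filtration[where \<rho> = "restriction N" and S = "\<lambda>k. supported (T k)"
        and B = "supported N" and t = "monomial d (inv\<^bsub>G\<^esub> s)" and t' = "monomial \<one>\<^bsub>K\<^esub> s"])
    show "subring (supported N) skew_ring" by (rule supported_subring[OF N])
    show "\<exists>e\<in>M. \<forall>x\<in>M. x \<star> e = x"
      if "M \<subseteq> supported N" "left_submodule (supported N) M skew_ring" for M
      by (rule maschke[OF fin N cop that])
    show "restriction N x \<in> supported N" if "x \<in> carrier skew_ring" for x
      by (rule restriction_supported[OF that])
    show "restriction N (x \<boxplus> y) = restriction N x \<boxplus> restriction N y"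
      if "x \<in> carrier skew_ring" "y \<in> carrier skew_ring" for x y
      by (rule restriction_add[OF that])
    show "restriction N (b \<star> x) = b \<star> restriction N x"
      if "b \<in> supported N" "x \<in> carrier skew_ring" for b x
      by (rule restriction_mult[OF N that])
    show "left_submodule (supported N) (supported (T k)) skew_ring" for k
    proof (rule A.left_submoduleI)
      show "b \<star> x \<in> supported (T k)" if "b \<in> supported N" "x \<in> supported (T k)" for b x
        using supported_mult[OF that] supported_mono[OF NT] by blast
    qed (auto simp: supported_zero supported_add supported_neg dest: supportedD)
    show "supported (T 0) = {\<zero>\<^bsub>skew_ring\<^esub>}"
      by (auto simp: T_def supported_zero supported_def coeff_support_def skew_zero_coeff intro!: skew_eqI A.zero_closed)
    show "supported (T k) \<subseteq> supported (T (Suc k))" for k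
      by (rule supported_mono) (auto simp: T_def intro: less_SucI)
    show "monomial d (inv\<^bsub>G\<^esub> s) \<in> carrier skew_ring" "monomial \<one>\<^bsub>K\<^esub> s \<in> carrier skew_ring"
      using d s by auto
    show "left_submodule (carrier skew_ring) L skew_ring" by (rule L)
    show "monomial \<one>\<^bsub>K\<^esub> s \<star> monomial d (inv\<^bsub>G\<^esub> s) = \<one>\<^bsub>skew_ring\<^esub>" by (rule ds)
    fix k x assume x: "x \<in> supported (T (Suc k))" and x0: "restriction N x = \<zero>\<^bsub>skew_ring\<^esub>"
    have "x g = \<zero>\<^bsub>K\<^esub>" if "g \<in> N" for g
      using that NG fun_cong[OF x0, of g] by (simp add: restriction_coeff skew_zero_coeff)
    then have xs: "x \<in> supported (T (Suc k) - N)"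
      using x by (auto simp: supported_def coeff_support_def)
    have "{inv\<^bsub>G\<^esub> s} <#>\<^bsub>G\<^esub> (T (Suc k) - N) \<subseteq> T k"
    proof
      fix g assume "g \<in> {inv\<^bsub>G\<^esub> s} <#>\<^bsub>G\<^esub> (T (Suc k) - N)"
      then obtain n i where g: "g = inv\<^bsub>G\<^esub> s \<otimes>\<^bsub>G\<^esub> (n \<otimes>\<^bsub>G\<^esub> s [^]\<^bsub>G\<^esub> i)" "n \<in> N" "i < Suc k"
        "n \<otimes>\<^bsub>G\<^esub> s [^]\<^bsub>G\<^esub> i \<notin> N"
        by (auto simp: set_mult_def T_def)
      \<comment> \<open>Exponent zero would give an element of N, where x vanishes. So one factor s
        is available for the shift, and normality returns the conjugate of n to N.\<close>
      then have "i \<noteq> 0" using NG by (intro notI) simp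
      then obtain j where j: "i = Suc j" by (cases i) auto
      have p: "s [^]\<^bsub>G\<^esub> i = s \<otimes>\<^bsub>G\<^esub> s [^]\<^bsub>G\<^esub> j" using s G.nat_pow_Suc2[of s j] by (simp add: j)
      have "g = (inv\<^bsub>G\<^esub> s \<otimes>\<^bsub>G\<^esub> n \<otimes>\<^bsub>G\<^esub> inv\<^bsub>G\<^esub> (inv\<^bsub>G\<^esub> s)) \<otimes>\<^bsub>G\<^esub> s [^]\<^bsub>G\<^esub> j"
        using s g NG by (simp add: p G.m_assoc)
      then show "g \<in> T k" using conj[of "inv\<^bsub>G\<^esub> s" n] s g j by (auto simp: T_def)
    qed
    moreover have "monomial d (inv\<^bsub>G\<^esub> s) \<star> x \<in> supported ({inv\<^bsub>G\<^esub> s} <#>\<^bsub>G\<^esub> (T (Suc k) - N))"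
      using d s by (intro supported_mult[OF _ xs] monomial_supported) auto
    ultimately show "monomial d (inv\<^bsub>G\<^esub> s) \<star> x \<in> supported (T k)" using supported_mono by blast
  qed
  moreover have "supported (T k) = carrier skew_ring"
    using supported_mono[OF full] supportedD supported_all by blast
  ultimately show ?thesis using A.left_submoduleD(1)[OF L] by blast
qed

subsection \<open>The double annihilator property\<close>

lemma trace_add:
  "f \<in> carrier skew_ring \<Longrightarrow> h \<in> carrier skew_ring \<Longrightarrow> (f \<boxplus> h) \<one>\<^bsub>G\<^esub> = f \<one>\<^bsub>G\<^esub> \<oplus>\<^bsub>K\<^esub> h \<one>\<^bsub>G\<^esub>"
  by (simp add: skew_add_coeff)

lemma mult_monomial_coeff:
  assumes "f \<in> carrier skew_ring" "x \<in> carrier G" "c \<in> carrier K" "g \<in> carrier G"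
  shows "(f \<star> monomial c x) g = f (g \<otimes>\<^bsub>G\<^esub> inv\<^bsub>G\<^esub> x) \<otimes>\<^bsub>K\<^esub> \<sigma> (g \<otimes>\<^bsub>G\<^esub> inv\<^bsub>G\<^esub> x) c \<otimes>\<^bsub>K\<^esub> \<alpha> (g \<otimes>\<^bsub>G\<^esub> inv\<^bsub>G\<^esub> x) x"
proof -
  have "(f \<star> monomial c x) g = finsum K (\<lambda>y. coeff_term f (monomial c x) (g \<otimes>\<^bsub>G\<^esub> inv\<^bsub>G\<^esub> y) y) {x}"
    using assms by (intro skew_mult_coeff_right) (auto simp: coeff_support_def monomial_coeff split: if_splits)
  also have "\<dots> = coeff_term f (monomial c x) (g \<otimes>\<^bsub>G\<^esub> inv\<^bsub>G\<^esub> x) x"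
    using assms by (simp add: coeff_term_closed)
  finally show ?thesis using assms by (simp add: coeff_term_def monomial_coeff)
qed

text \<open>If g lies in the support of z, multiplying by the basis element of the inverse of g, on
  either side, moves that coefficient to the identity. It gets changed only by a unit and, on the
  left, by an automorphism, so it stays nonzero.\<close>

lemma trace_nondegenerate:
  assumes z: "z \<in> carrier skew_ring" "z \<noteq> \<zero>\<^bsub>skew_ring\<^esub>"
  shows "\<exists>w\<in>carrier skew_ring. (z \<star> w) \<one>\<^bsub>G\<^esub> \<noteq> \<zero>\<^bsub>K\<^esub>" (is ?right)
    and "\<exists>w\<in>carrier skew_ring. (w \<star> z) \<one>\<^bsub>G\<^esub> \<noteq> \<zero>\<^bsub>K\<^esub>" (is ?left)
proof -
  obtain g where g: "g \<in> carrier G" "z g \<noteq> \<zero>\<^bsub>K\<^esub>"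
    using z skew_eqI[OF z(1) A.zero_closed] by (auto simp: skew_zero_coeff)
  let ?g = "inv\<^bsub>G\<^esub> g"
  have "(z \<star> monomial \<one>\<^bsub>K\<^esub> ?g) \<one>\<^bsub>G\<^esub> = z g \<otimes>\<^bsub>K\<^esub> \<alpha> g ?g"
    using z g by (simp add: mult_monomial_coeff sigma_simps skew_coeff)
  moreover have "z g \<otimes>\<^bsub>K\<^esub> \<alpha> g ?g \<noteq> \<zero>\<^bsub>K\<^esub>"
    using z g by (simp add: K.integral_iff skew_coeff alpha_simps)
  ultimately show ?right using g by (metis monomial_closed K.one_closed G.inv_closed)
  have "(monomial \<one>\<^bsub>K\<^esub> ?g \<star> z) \<one>\<^bsub>G\<^esub>
      = finsum K (\<lambda>x. coeff_term (monomial \<one>\<^bsub>K\<^esub> ?g) z x (inv\<^bsub>G\<^esub> x \<otimes>\<^bsub>G\<^esub> \<one>\<^bsub>G\<^esub>)) {?g}"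
    using z g by (intro skew_mult_coeff_left) (auto simp: coeff_support_def monomial_coeff split: if_splits)
  also have "\<dots> = \<sigma> ?g (z g) \<otimes>\<^bsub>K\<^esub> \<alpha> ?g g"
    using z g by (simp add: coeff_term_closed) (simp add: coeff_term_def monomial_coeff sigma_closed skew_coeff)
  also have "\<dots> \<noteq> \<zero>\<^bsub>K\<^esub>"
  proof -
    have "\<sigma> g (\<sigma> ?g (z g)) = z g" using z g by (simp add: sigma_comp sigma_one skew_coeff)
    then have "\<sigma> ?g (z g) \<noteq> \<zero>\<^bsub>K\<^esub>" using g by (metis sigma_simps(4))
    then show ?thesis using z g by (simp add: K.integral_iff sigma_closed skew_coeff alpha_simps)
  qed
  finally show ?left using g by (metis monomial_closed K.one_closed G.inv_closed)
qed

text \<open>A Riesz-type representation of right K-linear functionals. The trace of y a is itself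
  right linear in a, as \<sigma> is the identity at the neutral element, so both sides need
  comparing only on basis elements.\<close>

lemma trace_represents:
  assumes fin: "finite (carrier G)"
    and closed: "\<And>a. a \<in> carrier skew_ring \<Longrightarrow> \<phi> a \<in> carrier K"
    and add: "\<And>a b. a \<in> carrier skew_ring \<Longrightarrow> b \<in> carrier skew_ring \<Longrightarrow> \<phi> (a \<boxplus> b) = \<phi> a \<oplus>\<^bsub>K\<^esub> \<phi> b"
    and scale: "\<And>a c. a \<in> carrier skew_ring \<Longrightarrow> c \<in> carrier K \<Longrightarrow> \<phi> (a \<star> scalar c) = \<phi> a \<otimes>\<^bsub>K\<^esub> c"
  shows "\<exists>y\<in>carrier skew_ring. \<forall>a\<in>carrier skew_ring. \<phi> a = (y \<star> a) \<one>\<^bsub>G\<^esub>"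
proof -
  \<comment> \<open>The coefficients are forced by testing on the basis element of the inverse of g:
    the trace of its product with y is \<open>y g\<close> times
    \<open>\<alpha> g (inv g)\<close>.\<close>
  define y where "y = (\<lambda>g\<in>carrier G. \<phi> (monomial \<one>\<^bsub>K\<^esub> (inv\<^bsub>G\<^esub> g)) \<otimes>\<^bsub>K\<^esub> inv\<^bsub>K\<^esub> (\<alpha> g (inv\<^bsub>G\<^esub> g)))"
  have u: "\<alpha> g (inv\<^bsub>G\<^esub> g) \<in> Units K" if "g \<in> carrier G" for g
    using that by (simp add: K.field_Units alpha_simps)
  have "y \<in> carrier G \<rightarrow>\<^sub>E carrier K" using closed u by (simp add: y_def)
  then have y: "y \<in> carrier skew_ring" using fin by (simp add: skew_carrier coeff_support_def)
  have "\<phi> a = (y \<star> a) \<one>\<^bsub>G\<^esub>" if "a \<in> supported (carrier G)" for a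
    using that
  proof (induction rule: supported_induct)
    case zero
    have "\<phi> \<zero>\<^bsub>skew_ring\<^esub> = \<phi> \<zero>\<^bsub>skew_ring\<^esub> \<oplus>\<^bsub>K\<^esub> \<phi> \<zero>\<^bsub>skew_ring\<^esub>"
      using add[of "\<zero>\<^bsub>skew_ring\<^esub>" "\<zero>\<^bsub>skew_ring\<^esub>"] by simp
    then have "\<phi> \<zero>\<^bsub>skew_ring\<^esub> = \<zero>\<^bsub>K\<^esub>" using closed[of "\<zero>\<^bsub>skew_ring\<^esub>"] by (simp add: K.add.r_cancel_one')
    then show ?case using y by (simp add: skew_zero_coeff)
  next
    case (monomial d h)
    let ?h = "inv\<^bsub>G\<^esub> h" and ?u = "monomial \<one>\<^bsub>K\<^esub> h"
    have c: "\<sigma> ?h d \<in> carrier K" "\<phi> ?u \<in> carrier K" using monomial closed by (simp_all add: sigma_closed)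
    \<comment> \<open>Only right scalars can be pulled out of \<phi>, so d has to be moved across
      the basis element of h, which applies \<sigma> of the inverse of h.\<close>
    have "monomial d h = ?u \<star> scalar (\<sigma> ?h d)"
      using monomial c by (simp add: monomial_scalar_right sigma_comp sigma_one)
    then have phi: "\<phi> (monomial d h) = \<phi> ?u \<otimes>\<^bsub>K\<^esub> \<sigma> ?h d"
      using monomial c by (simp add: scale)
    have "(y \<star> monomial d h) \<one>\<^bsub>G\<^esub> = \<phi> ?u \<otimes>\<^bsub>K\<^esub> inv\<^bsub>K\<^esub> (\<alpha> ?h h) \<otimes>\<^bsub>K\<^esub> \<sigma> ?h d \<otimes>\<^bsub>K\<^esub> \<alpha> ?h h"
      using y monomial by (simp add: mult_monomial_coeff) (simp add: y_def)
    also have "\<dots> = \<phi> ?u \<otimes>\<^bsub>K\<^esub> \<sigma> ?h d \<otimes>\<^bsub>K\<^esub> (inv\<^bsub>K\<^esub> (\<alpha> ?h h) \<otimes>\<^bsub>K\<^esub> \<alpha> ?h h)"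
      using K.Units_inv_closed[OF u[of ?h]] monomial c by (simp add: K.m_ac alpha_simps)
    also have "\<dots> = \<phi> ?u \<otimes>\<^bsub>K\<^esub> \<sigma> ?h d" using monomial c u[of ?h] by simp
    finally show ?case using phi by simp
  next
    case (add f h)
    then show ?case using y assms(3)[of f h] by (simp add: supportedD A.r_distr trace_add)
  qed
  then show ?thesis using y supported_all by blast
qed

text \<open>A right linear functional vanishing on I but not at x has the form a -> trace of y a. As
  I absorbs right factors, the trace of (y a) v vanishes for every v when a is in I, and
  nondegeneracy upgrades this to y a = 0. That y x is nonzero is already visible in its
  trace.\<close>

lemma right_ideal_separation:
  assumes fin: "finite (carrier G)" "finite (carrier K)" and I: "right_ideal I skew_ring"
    and x: "x \<in> carrier skew_ring" "x \<notin> I"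
  shows "\<exists>y\<in>carrier skew_ring. (\<forall>a\<in>I. y \<star> a = \<zero>\<^bsub>skew_ring\<^esub>) \<and> y \<star> x \<noteq> \<zero>\<^bsub>skew_ring\<^esub>"
proof -
  interpret I: right_ideal I skew_ring by (rule I)
  have sc: "scalar c \<in> carrier skew_ring" if "c \<in> carrier K" for c using that by simp
  obtain \<pi> where pI: "\<pi> \<in> carrier skew_ring \<rightarrow> I" and pid: "\<And>u. u \<in> I \<Longrightarrow> \<pi> u = u"
    and padd: "\<And>a b. \<lbrakk>a \<in> carrier skew_ring; b \<in> carrier skew_ring\<rbrakk> \<Longrightarrow> \<pi> (a \<boxplus> b) = \<pi> a \<boxplus> \<pi> b"
    and psc: "\<And>c a. \<lbrakk>c \<in> carrier K; a \<in> carrier skew_ring\<rbrakk> \<Longrightarrow> \<pi> (a \<star> scalar c) = \<pi> a \<star> scalar c"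
  proof (rule A.action_projection[of K "\<lambda>c a. a \<star> scalar c" I])
    show "field K" by (rule K.field_axioms)
    show "additive_subgroup I skew_ring" by (rule I.additive_subgroup_axioms)
    show "u \<star> scalar c \<in> I" if "c \<in> carrier K" "u \<in> I" for c u using that I.I_r_closed sc by blast
    \<comment> \<open>A right action reverses the order of scalars, so commutativity of K is what
      makes this a module.\<close>
    show "a \<star> scalar (c \<otimes>\<^bsub>K\<^esub> d) = (a \<star> scalar d) \<star> scalar c"
      if "c \<in> carrier K" "d \<in> carrier K" "a \<in> carrier skew_ring" for c d a
    proof -
      have "scalar (c \<otimes>\<^bsub>K\<^esub> d) = scalar d \<star> scalar c"
        using that by (simp add: monomial_mult sigma_one alpha_l_one K.m_comm)
      then show ?thesis using that by (simp add: A.m_assoc)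
    qed
  qed (use fin skew_finite in \<open>auto simp: A.l_distr A.r_distr monomial_add monomial_one\<close>)
  have pC: "\<pi> a \<in> carrier skew_ring" if "a \<in> carrier skew_ring" for a
    using funcset_mem[OF pI that] I.a_subset by auto
  \<comment> \<open>The projection complementary to \<pi>: its kernel is I, so it kills I and not x,
    and it is still right linear.\<close>
  define z where "z a = a \<ominus>\<^bsub>skew_ring\<^esub> \<pi> a" for a
  have zC: "z a \<in> carrier skew_ring" if "a \<in> carrier skew_ring" for a
    using that pC by (simp add: z_def)
  have zI: "z a = \<zero>\<^bsub>skew_ring\<^esub>" if "a \<in> I" for a
    using that I.a_subset pid by (simp add: z_def a_minus_def A.r_neg subset_iff)
  have "z x \<noteq> \<zero>\<^bsub>skew_ring\<^esub>"
  proof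
    assume "z x = \<zero>\<^bsub>skew_ring\<^esub>"
    then have "x = \<pi> x" using x pC by (simp add: z_def)
    then show False using x funcset_mem[OF pI x(1)] by simp
  qed
  then obtain w where w: "w \<in> carrier skew_ring" "(w \<star> z x) \<one>\<^bsub>G\<^esub> \<noteq> \<zero>\<^bsub>K\<^esub>"
    using trace_nondegenerate(2)[OF zC[OF x(1)]] by blast
  have "\<exists>y\<in>carrier skew_ring. \<forall>a\<in>carrier skew_ring. (w \<star> z a) \<one>\<^bsub>G\<^esub> = (y \<star> a) \<one>\<^bsub>G\<^esub>"
  proof (rule trace_represents[OF fin(1)])
    fix a assume a: "a \<in> carrier skew_ring"
    show "(w \<star> z a) \<one>\<^bsub>G\<^esub> \<in> carrier K" using w zC a by (simp add: skew_coeff)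
    show "(w \<star> z (a \<boxplus> b)) \<one>\<^bsub>G\<^esub> = (w \<star> z a) \<one>\<^bsub>G\<^esub> \<oplus>\<^bsub>K\<^esub> (w \<star> z b) \<one>\<^bsub>G\<^esub>"
      if b: "b \<in> carrier skew_ring" for b
    proof -
      have "z (a \<boxplus> b) = z a \<boxplus> z b"
        using a b pC by (simp add: z_def padd a_minus_def A.minus_add A.a_ac)
      then show ?thesis using a b w zC by (simp add: A.r_distr trace_add)
    qed
    show "(w \<star> z (a \<star> scalar c)) \<one>\<^bsub>G\<^esub> = (w \<star> z a) \<one>\<^bsub>G\<^esub> \<otimes>\<^bsub>K\<^esub> c" if c: "c \<in> carrier K" for c
    proof -
      have "z (a \<star> scalar c) = z a \<star> scalar c"
        using a c pC by (simp add: z_def psc a_minus_def A.l_distr A.l_minus)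
      then have "w \<star> z (a \<star> scalar c) = (w \<star> z a) \<star> scalar c" using a c w zC by (simp add: A.m_assoc)
      then show ?thesis using a c w zC
        by (simp add: mult_monomial_coeff skew_coeff sigma_one alpha_r_one)
    qed
  qed
  then obtain y where y: "y \<in> carrier skew_ring"
    "\<And>a. a \<in> carrier skew_ring \<Longrightarrow> (w \<star> z a) \<one>\<^bsub>G\<^esub> = (y \<star> a) \<one>\<^bsub>G\<^esub>" by blast
  have "y \<star> a = \<zero>\<^bsub>skew_ring\<^esub>" if a: "a \<in> I" for a
  proof (rule ccontr)
    assume "y \<star> a \<noteq> \<zero>\<^bsub>skew_ring\<^esub>"
    moreover have aC: "a \<in> carrier skew_ring" using a I.a_subset by blast
    ultimately obtain v where v: "v \<in> carrier skew_ring" "((y \<star> a) \<star> v) \<one>\<^bsub>G\<^esub> \<noteq> \<zero>\<^bsub>K\<^esub>"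
      using trace_nondegenerate(1)[of "y \<star> a"] y(1) by blast
    have "((y \<star> a) \<star> v) \<one>\<^bsub>G\<^esub> = (w \<star> z (a \<star> v)) \<one>\<^bsub>G\<^esub>"
      using y aC v by (simp add: A.m_assoc)
    also have "\<dots> = \<zero>\<^bsub>K\<^esub>"
      using zI[OF I.I_r_closed[OF a v(1)]] w by (simp add: skew_zero_coeff)
    finally show False using v by simp
  qed
  moreover have "y \<star> x \<noteq> \<zero>\<^bsub>skew_ring\<^esub>"
    using w y(2)[OF x(1)] by (auto simp: skew_zero_coeff)
  ultimately show ?thesis using y(1) by blast
qed

section \<open>From principal left ideals to checkable right ideals\<close>

lemma code_checkable_if_left_ideals_principal:
  assumes fin: "finite (carrier G)" "finite (carrier K)"
    and principal: "\<And>L. left_submodule (carrier skew_ring) L skew_ring \<Longrightarrow>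
      \<exists>f\<in>L. \<forall>x\<in>L. \<exists>a\<in>carrier skew_ring. x = a \<star> f"
  shows "code_checkable skew_ring"
  unfolding code_checkable_def checkable_def
proof (intro allI impI)
  fix I assume I: "right_ideal I skew_ring"
  interpret I: right_ideal I skew_ring by (rule I)
  have IC: "x \<in> carrier skew_ring" if "x \<in> I" for x using that I.a_subset by blast
  define L where "L = {a \<in> carrier skew_ring. \<forall>x\<in>I. a \<star> x = \<zero>\<^bsub>skew_ring\<^esub>}"
  have "left_submodule (carrier skew_ring) L skew_ring"
    by (rule A.left_submoduleI) (auto simp: L_def IC A.l_distr A.l_minus A.m_assoc)
  then obtain v where v: "v \<in> L" "\<And>x. x \<in> L \<Longrightarrow> \<exists>a\<in>carrier skew_ring. x = a \<star> v"
    using principal by blast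
  have vC: "v \<in> carrier skew_ring" using v by (simp add: L_def)
  have ann: "x \<in> I" if x: "x \<in> carrier skew_ring" "v \<star> x = \<zero>\<^bsub>skew_ring\<^esub>" for x
  proof (rule ccontr)
    assume "x \<notin> I"
    then obtain y where y: "y \<in> L" "y \<star> x \<noteq> \<zero>\<^bsub>skew_ring\<^esub>"
      using right_ideal_separation[OF fin I x(1)] by (auto simp: L_def)
    then obtain a where "a \<in> carrier skew_ring" "y = a \<star> v" using v by blast
    then show False using y x vC by (simp add: A.m_assoc)
  qed
  have "I = right_annihilator skew_ring v"
  proof (intro equalityI subsetI)
    show "x \<in> right_annihilator skew_ring v" if "x \<in> I" for x
      using v(1) that I.a_subset by (auto simp: right_annihilator_def L_def)
    show "x \<in> I" if "x \<in> right_annihilator skew_ring v" for x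
      using that ann by (simp add: right_annihilator_def)
  qed
  then show "\<exists>v\<in>carrier skew_ring. I = right_annihilator skew_ring v" using vC by blast
qed

end

theorem proposition7:
  fixes G :: "('a, 'b) monoid_scheme" and K :: "('c, 'd) ring_scheme"
    and \<sigma> :: "'a \<Rightarrow> 'c \<Rightarrow> 'c" and \<alpha> :: "'a \<Rightarrow> 'a \<Rightarrow> 'c" and p n :: nat
  assumes "Factorial_Ring.prime p" and "n \<ge> 1"
    and "crossed_system G K \<sigma> \<alpha>"
    and "finite (carrier G)"
    and "finite (carrier K)" and "card (carrier K) = p ^ n"
    and "p_nilpotent p G"
    and "\<exists>P. sylow_subgroup p P G \<and> cyclic_group (G\<lparr>carrier := P\<rparr>)"
  shows "code_checkable (twisted_skew_group_ring G K \<sigma> \<alpha>)"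
proof -
  interpret crossed_system G K \<sigma> \<alpha> by (rule assms(3))
  obtain P where P: "sylow_subgroup p P G" "cyclic_group (G\<lparr>carrier := P\<rparr>)" using assms(8) by blast
  define N where "N = {x \<in> carrier G. coprime (G.ord x) p}"
  have N: "subgroup N G" using assms(7) by (simp add: p_nilpotent_def N_def)
  have "coprime (card N) p"
    unfolding N_def by (rule G.p_nilpotent_factorization(1)[OF assms(1,4,7) P(1)])
  then have cop: "coprime (card N) (card (carrier K))" by (simp add: assms(6))
  obtain s where s: "s \<in> carrier G" "\<And>g. g \<in> carrier G \<Longrightarrow> \<exists>n\<in>N. \<exists>i::nat. g = n \<otimes>\<^bsub>G\<^esub> s [^]\<^bsub>G\<^esub> i"
    using G.p_nilpotent_cyclic_sylow[OF assms(1,4,7) P] unfolding N_def by blast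
  have conj: "g \<otimes>\<^bsub>G\<^esub> m \<otimes>\<^bsub>G\<^esub> inv\<^bsub>G\<^esub> g \<in> N" if "g \<in> carrier G" "m \<in> N" for g m
    using that by (auto simp: N_def G.ord_conj)
  show ?thesis
    by (rule code_checkable_if_left_ideals_principal[OF assms(4,5)])
      (rule left_ideal_principal[OF assms(4,5) N cop conj s])
qed

end
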